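(* For every normal modal logic $\mathsf{L}$, the degree of fmp of $\mathsf{L}$ is either $1$ or $2^{\aleph_0}$.
   Context: A normal modal logic is a set of modal formulas containing the basic modal logic $\mathsf{K}$ and closed under modus ponens, substitution and necessitation. For a normal modal logic $\mathsf{L}$, $\mathsf{Fin}(\mathsf{L})$ is the class of finite Kripke frames validating $\mathsf{L}$. The degree of fmp of $\mathsf{L}$ is the cardinality of the set of normal modal logics $\mathsf{L}'$ with $\mathsf{Fin}(\mathsf{L}')=\mathsf{Fin}(\mathsf{L})$. *)

theory Defs
  imports Main
begin

unbundle cardinal_syntax

datatype fm = Var nat | Bot (\<open>\<^bold>\<bottom>\<close>) | Imp fm fm (infixr \<open>\<^bold>\<rightarrow>\<close> 55) | Box fm (\<open>\<box>_\<close> [80] 80)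

primrec subst :: "(nat \<Rightarrow> fm) \<Rightarrow> fm \<Rightarrow> fm" where
  "subst \<sigma> (Var p) = \<sigma> p"
| "subst \<sigma> \<^bold>\<bottom> = \<^bold>\<bottom>"
| "subst \<sigma> (\<phi> \<^bold>\<rightarrow> \<psi>) = subst \<sigma> \<phi> \<^bold>\<rightarrow> subst \<sigma> \<psi>"
| "subst \<sigma> (\<box>\<phi>) = \<box>(subst \<sigma> \<phi>)"

text \<open>Boxed formulas are treated as further propositional atoms, so that \<open>tautology\<close> describes
  the modal formulas that are substitution instances of classical propositional tautologies.\<close>

primrec bool_eval :: "(nat \<Rightarrow> bool) \<Rightarrow> (fm \<Rightarrow> bool) \<Rightarrow> fm \<Rightarrow> bool" where
  "bool_eval v b (Var p) = v p"
| "bool_eval v b \<^bold>\<bottom> = False"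
| "bool_eval v b (\<phi> \<^bold>\<rightarrow> \<psi>) = (bool_eval v b \<phi> \<longrightarrow> bool_eval v b \<psi>)"
| "bool_eval v b (\<box>\<phi>) = b \<phi>"

definition tautology :: "fm \<Rightarrow> bool" where
  "tautology \<phi> \<longleftrightarrow> (\<forall>v b. bool_eval v b \<phi>)"

definition closed_mp :: "fm set \<Rightarrow> bool" where
  "closed_mp L \<longleftrightarrow> (\<forall>\<phi> \<psi>. \<phi> \<^bold>\<rightarrow> \<psi> \<in> L \<longrightarrow> \<phi> \<in> L \<longrightarrow> \<psi> \<in> L)"

definition closed_subst :: "fm set \<Rightarrow> bool" where
  "closed_subst L \<longleftrightarrow> (\<forall>\<sigma> \<phi>. \<phi> \<in> L \<longrightarrow> subst \<sigma> \<phi> \<in> L)"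

definition closed_nec :: "fm set \<Rightarrow> bool" where
  "closed_nec L \<longleftrightarrow> (\<forall>\<phi>. \<phi> \<in> L \<longrightarrow> \<box>\<phi> \<in> L)"

inductive_set logic_K :: "fm set" where
  taut: "tautology \<phi> \<Longrightarrow> \<phi> \<in> logic_K"
| dist: "\<box>(\<phi> \<^bold>\<rightarrow> \<psi>) \<^bold>\<rightarrow> \<box>\<phi> \<^bold>\<rightarrow> \<box>\<psi> \<in> logic_K"
| mp: "\<phi> \<^bold>\<rightarrow> \<psi> \<in> logic_K \<Longrightarrow> \<phi> \<in> logic_K \<Longrightarrow> \<psi> \<in> logic_K"
| sub: "\<phi> \<in> logic_K \<Longrightarrow> subst \<sigma> \<phi> \<in> logic_K"
| nec: "\<phi> \<in> logic_K \<Longrightarrow> \<box>\<phi> \<in> logic_K"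

definition normal_modal_logic :: "fm set \<Rightarrow> bool" where
  "normal_modal_logic L \<longleftrightarrow> logic_K \<subseteq> L \<and> closed_mp L \<and> closed_subst L \<and> closed_nec L"

type_synonym 'w frame = "'w set \<times> ('w \<times> 'w) set"

definition kripke_frame :: "'w frame \<Rightarrow> bool" where
  "kripke_frame F \<longleftrightarrow> fst F \<noteq> {} \<and> snd F \<subseteq> fst F \<times> fst F"

primrec sat :: "'w frame \<Rightarrow> (nat \<Rightarrow> 'w set) \<Rightarrow> 'w \<Rightarrow> fm \<Rightarrow> bool" where
  "sat F V w (Var p) = (w \<in> V p)"
| "sat F V w \<^bold>\<bottom> = False"
| "sat F V w (\<phi> \<^bold>\<rightarrow> \<psi>) = (sat F V w \<phi> \<longrightarrow> sat F V w \<psi>)"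
| "sat F V w (\<box>\<phi>) = (\<forall>u. (w, u) \<in> snd F \<longrightarrow> sat F V u \<phi>)"

definition valid_on :: "'w frame \<Rightarrow> fm \<Rightarrow> bool" where
  "valid_on F \<phi> \<longleftrightarrow> (\<forall>V. (\<forall>p. V p \<subseteq> fst F) \<longrightarrow> (\<forall>w\<in>fst F. sat F V w \<phi>))"

definition validates :: "'w frame \<Rightarrow> fm set \<Rightarrow> bool" where
  "validates F L \<longleftrightarrow> (\<forall>\<phi>\<in>L. valid_on F \<phi>)"

text \<open>The class of all finite frames is represented by the set of finite frames whose worlds are
  natural numbers: every finite frame is isomorphic to one of these, and validity is invariant
  under isomorphism. By \<open>Fin_eq_imp_agree\<close> and \<open>Fin_eq_iff\<close> below, equality of these sets amounts
  to the two logics being validated by the same finite frames, whatever the type of their worlds.\<close>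

definition Fin :: "fm set \<Rightarrow> nat frame set" where
  "Fin L = {F. kripke_frame F \<and> finite (fst F) \<and> validates F L}"

text \<open>Cardinals are well-orders compared up to \<open>=o\<close>; \<open>|A|\<close> is the cardinality of \<open>A\<close>.\<close>

definition degree_of_fmp :: "fm set \<Rightarrow> fm set rel" where
  "degree_of_fmp L = |{L'. normal_modal_logic L' \<and> Fin L' = Fin L}|"

lemma valid_on_image:
  fixes F :: "'w frame" and f :: "'w \<Rightarrow> 'v"
  assumes F: "kripke_frame F" and inj: "inj_on f (fst F)"
  shows "valid_on (f ` fst F, map_prod f f ` snd F) \<phi> \<longleftrightarrow> valid_on F \<phi>"
    (is "valid_on ?G \<phi> \<longleftrightarrow> _")
proof -
  have R: "snd F \<subseteq> fst F \<times> fst F"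
    using F by (simp add: kripke_frame_def)
  have sat: "sat ?G U (f w) \<psi> \<longleftrightarrow> sat F V w \<psi>"
    if V: "\<And>p x. x \<in> fst F \<Longrightarrow> f x \<in> U p \<longleftrightarrow> x \<in> V p" and w: "w \<in> fst F" for U and V :: "nat \<Rightarrow> 'w set" and w \<psi>
    using w
  proof (induction \<psi> arbitrary: w)
    case (Box \<psi>)
    have dom: "x \<in> fst F" "y \<in> fst F" if "(x, y) \<in> snd F" for x y
      using R that by auto
    have succ: "(f w, u) \<in> snd ?G \<longleftrightarrow> (\<exists>x. u = f x \<and> (w, x) \<in> snd F)" for u
    proof
      assume "(f w, u) \<in> snd ?G"
      then obtain y x where yx: "(y, x) \<in> snd F" "f w = f y" "u = f x" by auto
      then have "w = y"
        using inj Box.prems dom by (simp add: inj_on_eq_iff)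
      then show "\<exists>x. u = f x \<and> (w, x) \<in> snd F"
        using yx by blast
    qed force
    have "sat ?G U (f w) (\<box>\<psi>) \<longleftrightarrow> (\<forall>x. (w, x) \<in> snd F \<longrightarrow> sat ?G U (f x) \<psi>)"
      unfolding sat.simps succ by blast
    also have "\<dots> \<longleftrightarrow> sat F V w (\<box>\<psi>)"
      using Box.IH dom by simp
    finally show ?case .
  qed (use V in auto)
  show ?thesis
  proof
    assume G: "valid_on ?G \<phi>"
    show "valid_on F \<phi>"
      unfolding valid_on_def
    proof (intro allI impI ballI)
      fix V :: "nat \<Rightarrow> 'w set" and w assume V: "\<forall>p. V p \<subseteq> fst F" and w: "w \<in> fst F"
      have "sat ?G (\<lambda>p. f ` V p) (f w) \<phi>"
        using G V w unfolding valid_on_def fst_conv by (metis imageI image_mono)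
      moreover have "f x \<in> f ` V p \<longleftrightarrow> x \<in> V p" if "x \<in> fst F" for p x
        using V that inj by (simp add: inj_on_image_mem_iff)
      ultimately show "sat F V w \<phi>"
        using sat[of "\<lambda>p. f ` V p" V w \<phi>] w by simp
    qed
  next
    assume G: "valid_on F \<phi>"
    show "valid_on ?G \<phi>"
      unfolding valid_on_def
    proof (intro allI impI ballI)
      fix U :: "nat \<Rightarrow> 'v set" and v assume "\<forall>p. U p \<subseteq> fst ?G" and "v \<in> fst ?G"
      then obtain w where w: "w \<in> fst F" "v = f w" by auto
      define V where "V p = {x \<in> fst F. f x \<in> U p}" for p
      have "V p \<subseteq> fst F" for p
        by (auto simp: V_def)
      then have "sat F V w \<phi>"
        using G w(1) unfolding valid_on_def by blast
      moreover have "sat ?G U (f w) \<phi> \<longleftrightarrow> sat F V w \<phi>"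
        by (rule sat) (use w(1) in \<open>simp_all add: V_def\<close>)
      ultimately show "sat ?G U v \<phi>"
        using w(2) by blast
    qed
  qed
qed

lemma Fin_eq_imp_agree:
  fixes F :: "'w frame"
  assumes "Fin L = Fin L'" and F: "kripke_frame F" "finite (fst F)"
  shows "validates F L \<longleftrightarrow> validates F L'"
proof -
  obtain f :: "'w \<Rightarrow> nat" where f: "inj_on f (fst F)"
    using F(2) finite_imp_inj_to_nat_seg by blast
  let ?G = "(f ` fst F, map_prod f f ` snd F)"
  have "kripke_frame ?G" "finite (fst ?G)"
    using F by (auto simp: kripke_frame_def)
  then have "validates ?G L \<longleftrightarrow> validates ?G L'"
    using assms(1) unfolding Fin_def by blast
  then show ?thesis
    unfolding validates_def valid_on_image[OF F(1) f] .
qed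

lemma Fin_eq_iff:
  assumes "infinite (UNIV :: 'w set)"
  shows "Fin L = Fin L' \<longleftrightarrow>
    (\<forall>F :: 'w frame. kripke_frame F \<and> finite (fst F) \<longrightarrow> (validates F L \<longleftrightarrow> validates F L'))"
proof
  assume agree: "\<forall>F :: 'w frame. kripke_frame F \<and> finite (fst F) \<longrightarrow>
    (validates F L \<longleftrightarrow> validates F L')"
  obtain f :: "nat \<Rightarrow> 'w" where "inj f"
    using assms infinite_countable_subset by blast
  have "validates F L \<longleftrightarrow> validates F L'" if F: "kripke_frame F" "finite (fst F)"
    for F :: "nat frame"
  proof -
    let ?G = "(f ` fst F, map_prod f f ` snd F)"
    have f: "inj_on f (fst F)"
      using \<open>inj f\<close> by (rule inj_on_subset) simp
    have "kripke_frame ?G" "finite (fst ?G)"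
      using F by (auto simp: kripke_frame_def)
    then have "validates ?G L \<longleftrightarrow> validates ?G L'"
      using agree by blast
    then show ?thesis
      unfolding validates_def valid_on_image[OF F(1) f] .
  qed
  then show "Fin L = Fin L'"
    unfolding Fin_def by blast
next
  assume "Fin L = Fin L'"
  then show "\<forall>F :: 'w frame. kripke_frame F \<and> finite (fst F) \<longrightarrow>
      (validates F L \<longleftrightarrow> validates F L')"
    by (simp add: Fin_eq_imp_agree[of L L'])
qed

end

theory Submission
  imports Defs "HOL.Topological_Spaces" "HOL-Library.Countable"
begin

text \<open>Let \<open>M\<close> be the logic of the finite frames of \<open>L\<close>; it is the largest logic with these
  finite frames. If the degree is not 1, some \<open>L'\<close> with the same finite frames is properly
  contained in \<open>M\<close>, say \<open>\<phi> \<in> M - L'\<close>, of modal depth \<open>d\<close>. The points of finite depth in the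
  canonical frame of \<open>L'\<close>, identified when they agree on the variables of \<open>\<phi>\<close>, form finite frames
  for \<open>L'\<close>, hence for \<open>M\<close>. So a point refuting \<open>\<phi>\<close> has depth more than \<open>d\<close>; unravel the canonical
  frame from such points for \<open>d\<close> steps, keep the points of finite depth as the finite frames above,
  and let the remaining leaves see a rigid infinite gadget. The rigidity makes infinitely many points
  of the gadget definable from every point that is not of finite depth, so that a finite frame of the
  logic of the result cannot refute \<open>M\<close>. A set \<open>I\<close> of natural numbers is coded into the gadget by
  making the corresponding points reflexive, and the intersections of \<open>M\<close> with the logics of these
  frames are continuum many logics with the same finite frames.\<close>

subsection \<open>Derived connectives\<close>

abbreviation neg :: "fm \<Rightarrow> fm" where "neg \<phi> \<equiv> \<phi> \<^bold>\<rightarrow> \<^bold>\<bottom>"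
abbreviation top :: fm where "top \<equiv> neg \<^bold>\<bottom>"
abbreviation dis :: "fm \<Rightarrow> fm \<Rightarrow> fm" where "dis \<phi> \<psi> \<equiv> neg \<phi> \<^bold>\<rightarrow> \<psi>"
abbreviation con :: "fm \<Rightarrow> fm \<Rightarrow> fm" where "con \<phi> \<psi> \<equiv> neg (\<phi> \<^bold>\<rightarrow> neg \<psi>)"
abbreviation dia :: "fm \<Rightarrow> fm" where "dia \<phi> \<equiv> neg (\<box>(neg \<phi>))"
abbreviation disl :: "fm list \<Rightarrow> fm" where "disl \<phi>s \<equiv> foldr dis \<phi>s \<^bold>\<bottom>"

primrec vars :: "fm \<Rightarrow> nat set" where
  "vars (Var p) = {p}"
| "vars \<^bold>\<bottom> = {}"
| "vars (\<phi> \<^bold>\<rightarrow> \<psi>) = vars \<phi> \<union> vars \<psi>"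
| "vars (\<box>\<phi>) = vars \<phi>"

primrec md :: "fm \<Rightarrow> nat" where
  "md (Var p) = 0"
| "md \<^bold>\<bottom> = 0"
| "md (\<phi> \<^bold>\<rightarrow> \<psi>) = max (md \<phi>) (md \<psi>)"
| "md (\<box>\<phi>) = Suc (md \<phi>)"

lemma finite_vars: "finite (vars \<phi>)"
  by (induction \<phi>) auto

lemma ex_fresh: "\<exists>p. p \<notin> vars \<phi>"
  using ex_new_if_finite[OF infinite_UNIV_nat finite_vars] .

lemma subst_ident: "(\<And>p. p \<in> vars \<phi> \<Longrightarrow> \<sigma> p = Var p) \<Longrightarrow> subst \<sigma> \<phi> = \<phi>"
  by (induction \<phi>) auto

lemma vars_subst: "(\<And>p. vars (\<sigma> p) \<subseteq> P) \<Longrightarrow> vars (subst \<sigma> \<phi>) \<subseteq> P"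
  by (induction \<phi>) auto

instance fm :: countable
  by countable_datatype

lemma sat_disl [simp]: "sat F V w (disl \<phi>s) \<longleftrightarrow> (\<exists>\<phi>\<in>set \<phi>s. sat F V w \<phi>)"
  by (induction \<phi>s) auto

lemma sat_cong_vars:
  "(\<And>p x. p \<in> vars \<phi> \<Longrightarrow> x \<in> V p \<longleftrightarrow> x \<in> V' p) \<Longrightarrow> sat F V w \<phi> \<longleftrightarrow> sat F V' w \<phi>"
proof (induction \<phi> arbitrary: w)
  case (Imp \<phi> \<psi>)
  then show ?case
    by (metis UnI1 UnI2 sat.simps(3) vars.simps(3))
qed simp_all

text \<open>Bounded morphisms preserve truth: the first assumption joins the back and forth
  conditions on the successor-closed part \<open>A\<close>. Serves for generated subframes and
  one-point frames.\<close>

lemma sat_morphism: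
  assumes "\<And>w u. w \<in> A \<Longrightarrow> (f w, u) \<in> snd F \<longleftrightarrow> (\<exists>x\<in>A. u = f x \<and> (w, x) \<in> snd G)"
    and "\<And>w x. w \<in> A \<Longrightarrow> (w, x) \<in> snd G \<Longrightarrow> x \<in> A"
    and "\<And>w p. w \<in> A \<Longrightarrow> f w \<in> V p \<longleftrightarrow> w \<in> V' p"
  shows "w \<in> A \<Longrightarrow> sat F V (f w) \<phi> \<longleftrightarrow> sat G V' w \<phi>"
proof (induction \<phi> arbitrary: w)
  case (Var p)
  then show ?case
    using assms(3) by simp
next
  case (Box \<phi>)
  have "sat F V (f w) (\<box>\<phi>) \<longleftrightarrow> (\<forall>x\<in>A. (w, x) \<in> snd G \<longrightarrow> sat F V (f x) \<phi>)"
    unfolding sat.simps assms(1)[OF Box.prems] by blast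
  also have "\<dots> \<longleftrightarrow> sat G V' w (\<box>\<phi>)"
    unfolding sat.simps using Box.IH assms(2)[OF Box.prems] by blast
  finally show ?case .
qed simp_all

lemma sat_restrict:
  assumes "kripke_frame F" "w \<in> fst F"
  shows "sat F V w \<phi> \<longleftrightarrow> sat F (\<lambda>p. V p \<inter> fst F) w \<phi>"
proof -
  have "sat F V (id w) \<phi> \<longleftrightarrow> sat F (\<lambda>p. V p \<inter> fst F) w \<phi>"
    by (rule sat_morphism[where A = "fst F"]) (use assms in \<open>auto simp: kripke_frame_def\<close>)
  then show ?thesis by simp
qed

text \<open>Evaluation started at a world never leaves the frame, so valuations need not be confined
  to the worlds.\<close>

lemma valid_onD:
  assumes "kripke_frame F" "valid_on F \<phi>" "w \<in> fst F"
  shows "sat F V w \<phi>"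
proof -
  have "sat F (\<lambda>p. V p \<inter> fst F) w \<phi>"
    by (rule assms(2)[unfolded valid_on_def, rule_format, OF _ assms(3)]) simp
  then show ?thesis
    using sat_restrict[OF assms(1,3)] by blast
qed

subsection \<open>Logics of frames\<close>

definition log :: "'w frame \<Rightarrow> fm set" where
  "log F = {\<phi>. valid_on F \<phi>}"

lemma sat_subst: "sat F V w (subst \<sigma> \<phi>) \<longleftrightarrow> sat F (\<lambda>p. {x. sat F V x (\<sigma> p)}) w \<phi>"
  by (induction \<phi> arbitrary: w) auto

text \<open>Truth at \<open>w\<close> is one of the evaluations over which \<open>tautology\<close>
  quantifies.\<close>

lemma bool_eval_sat: "bool_eval (\<lambda>p. w \<in> V p) (\<lambda>\<phi>. sat F V w (\<box>\<phi>)) \<phi> \<longleftrightarrow> sat F V w \<phi>"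
  by (induction \<phi>) auto

lemma valid_subst:
  assumes "kripke_frame F" "valid_on F \<phi>"
  shows "valid_on F (subst \<sigma> \<phi>)"
  unfolding valid_on_def sat_subst using valid_onD[OF assms] by simp

lemma normal_log:
  assumes F: "kripke_frame F"
  shows "normal_modal_logic (log F)"
proof -
  have nec: "valid_on F (\<box>\<phi>)" if "valid_on F \<phi>" for \<phi>
    using F that unfolding valid_on_def kripke_frame_def by auto
  have "valid_on F \<phi>" if "\<phi> \<in> logic_K" for \<phi>
    using that
  proof induction
    case (taut \<phi>)
    then have "sat F V w \<phi>" for V w
      using bool_eval_sat[of w V F \<phi>] unfolding tautology_def by simp
    then show ?case
      unfolding valid_on_def by simp
  next
    case (sub \<phi> \<sigma>)
    then show ?case
      using F valid_subst by blast
  qed (use nec in \<open>auto simp: valid_on_def\<close>)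
  then have "logic_K \<subseteq> log F" "closed_mp (log F)"
    unfolding log_def closed_mp_def by (auto simp: valid_on_def)
  moreover have "closed_subst (log F)" "closed_nec (log F)"
    unfolding log_def closed_subst_def closed_nec_def using nec valid_subst[OF F] by simp_all
  ultimately show ?thesis
    unfolding normal_modal_logic_def by simp
qed

lemma closed_mpD: "closed_mp T \<Longrightarrow> \<phi> \<^bold>\<rightarrow> \<psi> \<in> T \<Longrightarrow> \<phi> \<in> T \<Longrightarrow> \<psi> \<in> T"
  unfolding closed_mp_def by (elim allE impE)

lemma normal_Inter:
  assumes "\<And>L. L \<in> \<L> \<Longrightarrow> normal_modal_logic L"
  shows "normal_modal_logic (\<Inter>\<L>)"
proof -
  have L: "logic_K \<subseteq> L" "closed_mp L" "closed_subst L" "closed_nec L" if "L \<in> \<L>" for L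
    using assms[OF that] unfolding normal_modal_logic_def by simp_all
  have "closed_mp (\<Inter>\<L>)"
    unfolding closed_mp_def
  proof (intro allI impI InterI)
    fix \<phi> \<psi> L assume "\<phi> \<^bold>\<rightarrow> \<psi> \<in> \<Inter>\<L>" "\<phi> \<in> \<Inter>\<L>" "L \<in> \<L>"
    then show "\<psi> \<in> L"
      using closed_mpD[OF L(2)[OF \<open>L \<in> \<L>\<close>], of \<phi> \<psi>] by simp
  qed
  moreover have "closed_subst (\<Inter>\<L>)" "closed_nec (\<Inter>\<L>)"
    using L(3,4) by (simp_all add: closed_subst_def closed_nec_def)
  ultimately show ?thesis
    unfolding normal_modal_logic_def using L(1) by (simp add: Inter_greatest)
qed

lemma normal_Int: "normal_modal_logic L \<Longrightarrow> normal_modal_logic L' \<Longrightarrow> normal_modal_logic (L \<inter> L')"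
  using normal_Inter[of "{L, L'}"] by auto

subsection \<open>Maximal consistent sets\<close>

text \<open>The points of the canonical frame, whose accessibility relation is
  \<open>canon\<close>.\<close>

definition mcs :: "fm set \<Rightarrow> fm set \<Rightarrow> bool" where
  "mcs L T \<longleftrightarrow> L \<subseteq> T \<and> closed_mp T \<and> \<^bold>\<bottom> \<notin> T \<and> (\<forall>\<phi>. \<phi> \<in> T \<or> neg \<phi> \<in> T)"

definition canon :: "fm set \<Rightarrow> fm set \<Rightarrow> bool" where
  "canon T T' \<longleftrightarrow> (\<forall>\<phi>. \<box>\<phi> \<in> T \<longrightarrow> \<phi> \<in> T')"

lemma normal_taut: "normal_modal_logic L \<Longrightarrow> tautology \<phi> \<Longrightarrow> \<phi> \<in> L"
  unfolding normal_modal_logic_def using logic_K.taut by auto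

text \<open>Zorn's lemma yields \<open>S\<close> maximal among the mp-closed sets extending
  \<open>T\<close> and omitting \<open>\<phi>\<close>. Maximality puts the implication from a
  missing formula to \<open>\<phi>\<close> into \<open>S\<close>; were a formula and its negation
  both missing, \<open>\<phi>\<close> would follow by cases.\<close>

lemma Lindenbaum:
  assumes L: "normal_modal_logic L" "L \<subseteq> T" and T: "closed_mp T" "\<phi> \<notin> T"
  obtains T' where "mcs L T'" "T \<subseteq> T'" "\<phi> \<notin> T'"
proof -
  let ?\<A> = "{T'. T \<subseteq> T' \<and> closed_mp T' \<and> \<phi> \<notin> T'}"
  have "\<exists>S\<in>?\<A>. \<forall>S'\<in>?\<A>. S \<subseteq> S' \<longrightarrow> S' = S"
  proof (rule subset_Zorn_nonempty)
    fix \<C> assume \<C>: "\<C> \<noteq> {}" "subset.chain ?\<A> \<C>"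
    have "closed_mp (\<Union>\<C>)"
      unfolding closed_mp_def
    proof (intro allI impI)
      fix \<alpha> \<beta> assume "\<alpha> \<^bold>\<rightarrow> \<beta> \<in> \<Union>\<C>" "\<alpha> \<in> \<Union>\<C>"
      then obtain A B where AB: "A \<in> \<C>" "B \<in> \<C>" "\<alpha> \<^bold>\<rightarrow> \<beta> \<in> A" "\<alpha> \<in> B" by blast
      then have "A \<subseteq> B \<or> B \<subseteq> A" "closed_mp A" "closed_mp B"
        using \<C>(2) unfolding subset_chain_def by auto
      then have "\<beta> \<in> A \<or> \<beta> \<in> B"
        using AB(3,4) closed_mpD[of A \<alpha> \<beta>] closed_mpD[of B \<alpha> \<beta>] by auto
      then show "\<beta> \<in> \<Union>\<C>"
        using AB(1,2) by auto
    qed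
    then show "\<Union>\<C> \<in> ?\<A>"
      using \<C> unfolding subset_chain_def by blast
  qed (use T in blast)
  then obtain S where "S \<in> ?\<A>" and maximal: "\<forall>S'\<in>?\<A>. S \<subseteq> S' \<longrightarrow> S' = S" ..
  then have S: "T \<subseteq> S" "closed_mp S" "\<phi> \<notin> S" by auto
  have max: "S' = S" if "T \<subseteq> S'" "closed_mp S'" "\<phi> \<notin> S'" "S \<subseteq> S'" for S'
    using maximal that by simp
  have taut: "\<psi> \<in> S" if "tautology \<psi>" for \<psi>
    using normal_taut[OF L(1) that] L(2) S(1) by auto
  have mp: "\<beta> \<in> S" if "\<alpha> \<^bold>\<rightarrow> \<beta> \<in> S" "\<alpha> \<in> S" for \<alpha> \<beta>
    using closed_mpD[OF S(2) that] .
  have imp: "\<psi> \<^bold>\<rightarrow> \<phi> \<in> S" if "\<psi> \<notin> S" for \<psi>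
  proof (rule ccontr)
    assume "\<psi> \<^bold>\<rightarrow> \<phi> \<notin> S"
    \<comment> \<open>By the deduction theorem this is the mp-closure of \<open>S\<close> with
      \<open>\<psi>\<close> added; as it omits \<open>\<phi>\<close>, maximality makes it equal to
      \<open>S\<close>, against the absence of \<open>\<psi>\<close>.\<close>
    let ?S' = "{\<chi>. \<psi> \<^bold>\<rightarrow> \<chi> \<in> S}"
    have "closed_mp ?S'"
      unfolding closed_mp_def
    proof (intro allI impI CollectI)
      fix \<alpha> \<beta> assume "\<alpha> \<^bold>\<rightarrow> \<beta> \<in> ?S'" "\<alpha> \<in> ?S'"
      then have *: "\<psi> \<^bold>\<rightarrow> \<alpha> \<^bold>\<rightarrow> \<beta> \<in> S" "\<psi> \<^bold>\<rightarrow> \<alpha> \<in> S" by auto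
      have dist: "(\<psi> \<^bold>\<rightarrow> \<alpha> \<^bold>\<rightarrow> \<beta>) \<^bold>\<rightarrow> (\<psi> \<^bold>\<rightarrow> \<alpha>) \<^bold>\<rightarrow> \<psi> \<^bold>\<rightarrow> \<beta> \<in> S"
        by (rule taut) (simp add: tautology_def)
      show "\<psi> \<^bold>\<rightarrow> \<beta> \<in> S"
        using mp[OF mp[OF dist *(1)] *(2)] .
    qed
    moreover have sub: "S \<subseteq> ?S'"
    proof (intro subsetI CollectI)
      fix \<chi> assume \<chi>: "\<chi> \<in> S"
      have weak: "\<chi> \<^bold>\<rightarrow> \<psi> \<^bold>\<rightarrow> \<chi> \<in> S"
        by (rule taut) (simp add: tautology_def)
      show "\<psi> \<^bold>\<rightarrow> \<chi> \<in> S"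
        using mp[OF weak \<chi>] .
    qed
    moreover have "T \<subseteq> ?S'"
      using S(1) sub by (rule order_trans)
    ultimately have "?S' = S"
      using \<open>\<psi> \<^bold>\<rightarrow> \<phi> \<notin> S\<close> max[of ?S'] by simp
    moreover have "\<psi> \<^bold>\<rightarrow> \<psi> \<in> S"
      by (rule taut) (simp add: tautology_def)
    ultimately show False
      using that by auto
  qed
  have "\<psi> \<in> S \<or> neg \<psi> \<in> S" for \<psi>
  proof (rule ccontr)
    assume "\<not> ?thesis"
    then have *: "\<psi> \<^bold>\<rightarrow> \<phi> \<in> S" "neg \<psi> \<^bold>\<rightarrow> \<phi> \<in> S"
      using imp by simp_all
    have cases: "(\<psi> \<^bold>\<rightarrow> \<phi>) \<^bold>\<rightarrow> (neg \<psi> \<^bold>\<rightarrow> \<phi>) \<^bold>\<rightarrow> \<phi> \<in> S"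
      by (rule taut) (auto simp: tautology_def)
    show False
      using mp[OF mp[OF cases *(1)] *(2)] S(3) by contradiction
  qed
  moreover have "\<^bold>\<bottom> \<^bold>\<rightarrow> \<phi> \<in> S"
    by (rule taut) (simp add: tautology_def)
  then have "\<^bold>\<bottom> \<notin> S"
    using mp[of "\<^bold>\<bottom>" \<phi>] S(3) by auto
  ultimately have "mcs L S"
    unfolding mcs_def using S L(2) by simp
  then show thesis
    using that S by simp
qed

lemma mcs_D:
  assumes "mcs L T"
  shows "L \<subseteq> T" "closed_mp T" "\<^bold>\<bottom> \<notin> T" "\<phi> \<in> T \<or> neg \<phi> \<in> T"
  using assms unfolding mcs_def by simp_all

lemma mcs_imp:
  assumes L: "normal_modal_logic L" and T: "mcs L T"
  shows "\<phi> \<^bold>\<rightarrow> \<psi> \<in> T \<longleftrightarrow> (\<phi> \<in> T \<longrightarrow> \<psi> \<in> T)"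
proof
  have mp: "\<alpha> \<in> T \<longrightarrow> \<beta> \<in> T" if "\<alpha> \<^bold>\<rightarrow> \<beta> \<in> T" for \<alpha> \<beta>
    using closed_mpD[OF mcs_D(2)[OF T] that] ..
  have "neg \<phi> \<^bold>\<rightarrow> \<phi> \<^bold>\<rightarrow> \<psi> \<in> L" "\<psi> \<^bold>\<rightarrow> \<phi> \<^bold>\<rightarrow> \<psi> \<in> L"
    by (rule normal_taut[OF L], simp add: tautology_def)+
  then have "neg \<phi> \<^bold>\<rightarrow> \<phi> \<^bold>\<rightarrow> \<psi> \<in> T" "\<psi> \<^bold>\<rightarrow> \<phi> \<^bold>\<rightarrow> \<psi> \<in> T"
    using mcs_D(1)[OF T] by auto
  moreover have "neg \<phi> \<in> T \<or> \<phi> \<in> T"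
    using mcs_D(4)[OF T] by auto
  ultimately show "\<phi> \<^bold>\<rightarrow> \<psi> \<in> T" if "\<phi> \<in> T \<longrightarrow> \<psi> \<in> T"
    using mp[of "neg \<phi>" "\<phi> \<^bold>\<rightarrow> \<psi>"] mp[of \<psi> "\<phi> \<^bold>\<rightarrow> \<psi>"] that by auto
  show "\<phi> \<in> T \<longrightarrow> \<psi> \<in> T" if "\<phi> \<^bold>\<rightarrow> \<psi> \<in> T"
    using mp[OF that] .
qed

text \<open>If the box is missing, the formulas boxed in \<open>T\<close> form an mp-closed set that
  contains \<open>L\<close> by necessitation and omits \<open>\<phi>\<close>; Lindenbaum's lemma
  extends it to a refuting successor.\<close>

lemma mcs_box:
  assumes L: "normal_modal_logic L" and T: "mcs L T"
  shows "\<box>\<phi> \<in> T \<longleftrightarrow> (\<forall>T'. mcs L T' \<longrightarrow> canon T T' \<longrightarrow> \<phi> \<in> T')"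
proof
  assume *: "\<forall>T'. mcs L T' \<longrightarrow> canon T T' \<longrightarrow> \<phi> \<in> T'"
  show "\<box>\<phi> \<in> T"
  proof (rule ccontr)
    assume "\<box>\<phi> \<notin> T"
    have "L \<subseteq> {\<psi>. \<box>\<psi> \<in> T}"
      using L mcs_D(1)[OF T] unfolding normal_modal_logic_def closed_nec_def by auto
    moreover have "\<box>(\<psi> \<^bold>\<rightarrow> \<chi>) \<^bold>\<rightarrow> \<box>\<psi> \<^bold>\<rightarrow> \<box>\<chi> \<in> T" for \<psi> \<chi>
      using L mcs_D(1)[OF T] logic_K.dist[of \<psi> \<chi>] unfolding normal_modal_logic_def by auto
    then have "closed_mp {\<psi>. \<box>\<psi> \<in> T}"
      unfolding closed_mp_def mcs_imp[OF L T] by simp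
    ultimately obtain T' where "mcs L T'" "{\<psi>. \<box>\<psi> \<in> T} \<subseteq> T'" "\<phi> \<notin> T'"
      using Lindenbaum[OF L, of "{\<psi>. \<box>\<psi> \<in> T}" \<phi>] \<open>\<box>\<phi> \<notin> T\<close> by auto
    then show False
      using * unfolding canon_def by auto
  qed
qed (auto simp: canon_def)

lemma mcs_complete:
  assumes L: "normal_modal_logic L" and all: "\<And>T. mcs L T \<Longrightarrow> \<phi> \<in> T"
  shows "\<phi> \<in> L"
proof (rule ccontr)
  assume "\<phi> \<notin> L"
  moreover have "closed_mp L"
    using L unfolding normal_modal_logic_def by simp
  ultimately obtain T where "mcs L T" "\<phi> \<notin> T"
    using Lindenbaum[OF L order_refl] by metis
  then show False
    using all by blast
qed

subsection \<open>Finite depth\<close>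

text \<open>The iterated box before falsum excludes canonical paths of \<open>n\<close> steps, so
  \<open>n\<close> bounds the number of points on a path and level \<open>0\<close> is
  empty.\<close>

definition fin_depth :: "fm set \<Rightarrow> nat \<Rightarrow> fm set set" where
  "fin_depth L n = {T. mcs L T \<and> (Box ^^ n) \<^bold>\<bottom> \<in> T}"

definition restr :: "nat set \<Rightarrow> fm set \<Rightarrow> fm set" where
  "restr P T = {\<phi> \<in> T. vars \<phi> \<subseteq> P}"

text \<open>The quotient by agreement on formulas over \<open>P\<close>, with the least relation:
  classes are related as soon as some representatives are.\<close>

definition depth_frame :: "fm set \<Rightarrow> nat set \<Rightarrow> nat \<Rightarrow> fm set frame" where
  "depth_frame L P n = (restr P ` fin_depth L n,
    {(restr P T, restr P T') | T T'. T \<in> fin_depth L n \<and> T' \<in> fin_depth L n \<and> canon T T'})"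

lemma restr_eqD: "restr P T = restr P T' \<Longrightarrow> vars \<phi> \<subseteq> P \<Longrightarrow> \<phi> \<in> T \<longleftrightarrow> \<phi> \<in> T'"
  unfolding restr_def by blast

context
  fixes L :: "fm set"
  assumes L: "normal_modal_logic L"
begin

lemma fin_depth_mcs: "T \<in> fin_depth L n \<Longrightarrow> mcs L T"
  unfolding fin_depth_def by blast

lemma fin_depth_0: "fin_depth L 0 = {}"
  by (simp add: fin_depth_def mcs_D(3))

lemma fin_depth_Suc:
  "T \<in> fin_depth L (Suc n) \<longleftrightarrow> mcs L T \<and> (\<forall>T'. mcs L T' \<longrightarrow> canon T T' \<longrightarrow> T' \<in> fin_depth L n)"
  by (cases "mcs L T") (simp_all add: fin_depth_def mcs_box[OF L] cong: imp_cong)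

lemma fin_depth_mono_Suc: "fin_depth L n \<subseteq> fin_depth L (Suc n)"
proof (induction n)
  case (Suc n)
  show ?case
  proof
    fix T assume "T \<in> fin_depth L (Suc n)"
    then show "T \<in> fin_depth L (Suc (Suc n))"
      unfolding fin_depth_Suc[of T] using Suc.IH by (simp add: subset_iff)
  qed
qed (simp add: fin_depth_0)

lemma fin_depth_mono: "n \<le> m \<Longrightarrow> fin_depth L n \<subseteq> fin_depth L m"
  using lift_Suc_mono_le[of "fin_depth L"] fin_depth_mono_Suc by simp

lemma fin_depth_canon: "T \<in> fin_depth L n \<Longrightarrow> mcs L T' \<Longrightarrow> canon T T' \<Longrightarrow> T' \<in> fin_depth L n"
  using subsetD[OF fin_depth_mono_Suc, of T n] fin_depth_Suc[of T n] by simp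

text \<open>Induction on the depth: one level up, membership of a formula depends only on the
  variables at the point and on which of the finitely many sets definable below contain all
  successors. \<open>key\<close> records exactly this.\<close>

lemma finite_extensions:
  assumes P: "finite P"
  shows "finite ((\<lambda>\<phi>. {T \<in> fin_depth L n. \<phi> \<in> T}) ` {\<phi>. vars \<phi> \<subseteq> P})"
proof (induction n)
  case 0
  have "(\<lambda>\<phi>. {T \<in> fin_depth L 0. \<phi> \<in> T}) ` {\<phi>. vars \<phi> \<subseteq> P} \<subseteq> {{}}"
    by (auto simp: fin_depth_0)
  then show ?case
    using finite_subset by blast
next
  case (Suc n)
  let ?D = "fin_depth L (Suc n)"
  let ?A = "(\<lambda>\<phi>. {T \<in> fin_depth L n. \<phi> \<in> T}) ` {\<phi>. vars \<phi> \<subseteq> P}"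
  define key where "key T = ({p \<in> P. Var p \<in> T}, {a \<in> ?A. \<forall>T'. mcs L T' \<longrightarrow> canon T T' \<longrightarrow> T' \<in> a})" for T
  have key: "\<phi> \<in> T \<longleftrightarrow> \<phi> \<in> T'" if "vars \<phi> \<subseteq> P" "T \<in> ?D" "T' \<in> ?D" "key T = key T'" for \<phi> T T'
    using that(1)
  proof (induction \<phi>)
    case (Box \<phi>)
    have mem: "\<box>\<phi> \<in> S \<longleftrightarrow> {T \<in> fin_depth L n. \<phi> \<in> T} \<in> snd (key S)" if "S \<in> ?D" for S
      using that Box.prems mcs_box[OF L fin_depth_mcs[OF that]] unfolding key_def fin_depth_Suc by auto
    show ?case
      unfolding mem[OF \<open>T \<in> ?D\<close>] mem[OF \<open>T' \<in> ?D\<close>] \<open>key T = key T'\<close> ..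
  qed (use \<open>key T = key T'\<close> \<open>T \<in> ?D\<close> \<open>T' \<in> ?D\<close> in
      \<open>auto simp: key_def mcs_imp[OF L fin_depth_mcs] dest: mcs_D(3)[OF fin_depth_mcs]\<close>)
  \<comment> \<open>The set defined by a formula is a preimage under \<open>key\<close>, so finitely
    many keys leave finitely many such sets.\<close>
  have "(\<lambda>\<phi>. {T \<in> ?D. \<phi> \<in> T}) ` {\<phi>. vars \<phi> \<subseteq> P} \<subseteq> (\<lambda>K. {T \<in> ?D. key T \<in> K}) ` Pow (key ` ?D)"
  proof (rule image_subsetI)
    fix \<phi> assume "\<phi> \<in> {\<phi>. vars \<phi> \<subseteq> P}"
    then have "{T \<in> ?D. \<phi> \<in> T} = {T \<in> ?D. key T \<in> key ` {T \<in> ?D. \<phi> \<in> T}}"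
      using key[of \<phi>] by blast
    then show "{T \<in> ?D. \<phi> \<in> T} \<in> (\<lambda>K. {T \<in> ?D. key T \<in> K}) ` Pow (key ` ?D)"
      by (rule image_eqI) blast
  qed
  moreover have "key ` ?D \<subseteq> Pow P \<times> Pow ?A"
    unfolding key_def by blast
  then have "finite (key ` ?D)"
    using P Suc.IH by (meson finite_Pow_iff finite_SigmaI finite_subset)
  ultimately show ?case
    by (meson finite_Pow_iff finite_imageI finite_subset)
qed

text \<open>The finite family of definable sets is closed under finite unions and intersections, so
  every class, and then every set of classes, is definable. This turns valuations on the quotient
  into substitutions.\<close>

lemma restr_definable:
  assumes P: "finite P"
  obtains \<chi> where "vars \<chi> \<subseteq> P" "\<And>T. T \<in> fin_depth L n \<Longrightarrow> \<chi> \<in> T \<longleftrightarrow> restr P T \<in> X"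
proof -
  let ?D = "fin_depth L n"
  let ?A = "(\<lambda>\<phi>. {T \<in> ?D. \<phi> \<in> T}) ` {\<phi>. vars \<phi> \<subseteq> P}"
  have bool: "\<^bold>\<bottom> \<notin> T" "neg \<phi> \<in> T \<longleftrightarrow> \<phi> \<notin> T" "dis \<phi> \<psi> \<in> T \<longleftrightarrow> \<phi> \<in> T \<or> \<psi> \<in> T"
    "con \<phi> \<psi> \<in> T \<longleftrightarrow> \<phi> \<in> T \<and> \<psi> \<in> T" if "T \<in> ?D" for T \<phi> \<psi>
    using mcs_D(3)[OF fin_depth_mcs[OF that]] by (auto simp: mcs_imp[OF L fin_depth_mcs[OF that]])
  have A: "{T \<in> ?D. \<phi> \<in> T} \<in> ?A" if "vars \<phi> \<subseteq> P" for \<phi>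
    using that by (intro imageI) simp
  have union: "\<Union>F \<in> ?A" if "finite F" "F \<subseteq> ?A" for F
    using that
  proof (induction F rule: finite_induct)
    case empty
    have "{T \<in> ?D. \<^bold>\<bottom> \<in> T} = {}"
      using bool(1) by simp
    then show ?case
      using A[of "\<^bold>\<bottom>"] by simp
  next
    case (insert a F)
    then have "a \<in> ?A" "\<Union>F \<in> ?A" by simp_all
    then obtain \<phi> \<psi> where *: "vars \<phi> \<subseteq> P" "a = {T \<in> ?D. \<phi> \<in> T}" "vars \<psi> \<subseteq> P" "\<Union>F = {T \<in> ?D. \<psi> \<in> T}"
      by (elim imageE) simp
    have "{T \<in> ?D. dis \<phi> \<psi> \<in> T} = {T \<in> ?D. \<phi> \<in> T} \<union> {T \<in> ?D. \<psi> \<in> T}"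
      using bool(3) by blast
    then show ?case
      using A[of "dis \<phi> \<psi>"] * by simp
  qed
  have inter: "?D \<inter> \<Inter>F \<in> ?A" if "finite F" "F \<subseteq> ?A" for F
    using that
  proof (induction F rule: finite_induct)
    case empty
    have "{T \<in> ?D. top \<in> T} = ?D"
      using bool(1,2) by blast
    then show ?case
      using A[of top] by simp
  next
    case (insert a F)
    then have "a \<in> ?A" "?D \<inter> \<Inter>F \<in> ?A" by simp_all
    then obtain \<phi> \<psi> where *: "vars \<phi> \<subseteq> P" "a = {T \<in> ?D. \<phi> \<in> T}" "vars \<psi> \<subseteq> P" "?D \<inter> \<Inter>F = {T \<in> ?D. \<psi> \<in> T}"
      by (elim imageE) simp
    have "{T \<in> ?D. con \<phi> \<psi> \<in> T} = {T \<in> ?D. \<phi> \<in> T} \<inter> {T \<in> ?D. \<psi> \<in> T}"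
      using bool(4) by blast
    also have "\<dots> = a \<inter> (?D \<inter> \<Inter>F)"
      using * by simp
    also have "\<dots> = ?D \<inter> \<Inter>(insert a F)"
      by auto
    finally show ?case
      using A[of "con \<phi> \<psi>"] * by simp
  qed
  \<comment> \<open>Definability of complements makes this least definable set around
    \<open>T\<close> equal to the class of \<open>T\<close>.\<close>
  define B where "B T = ?D \<inter> \<Inter>{a \<in> ?A. T \<in> a}" for T
  have B: "B T = {T' \<in> ?D. restr P T' = restr P T}" if T: "T \<in> ?D" for T
  proof -
    have "restr P T' = restr P T" if T': "T' \<in> B T" for T'
    proof -
      have "T' \<in> ?D"
        using T' unfolding B_def by blast
      have sub: "\<phi> \<in> T'" if "\<phi> \<in> T" "vars \<phi> \<subseteq> P" for \<phi>
      proof -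
        have "{S \<in> ?D. \<phi> \<in> S} \<in> {a \<in> ?A. T \<in> a}"
          using A[OF that(2)] T that(1) by simp
        then have "T' \<in> {S \<in> ?D. \<phi> \<in> S}"
          using T' unfolding B_def by (meson IntD2 InterD)
        then show ?thesis by simp
      qed
      have "\<phi> \<in> T" if "\<phi> \<in> T'" "vars \<phi> \<subseteq> P" for \<phi>
        using sub[of "neg \<phi>"] that bool(2)[OF T, of \<phi>] bool(2)[OF \<open>T' \<in> ?D\<close>, of \<phi>] by auto
      then show ?thesis
        using sub unfolding restr_def by blast
    qed
    moreover have "T' \<in> B T" if "T' \<in> ?D" "restr P T' = restr P T" for T'
      using that restr_eqD[of P T' T] T unfolding B_def by auto
    moreover have "B T \<subseteq> ?D"
      unfolding B_def by blast
    ultimately show ?thesis by blast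
  qed
  have fin: "finite ?A"
    using finite_extensions[OF P] .
  have "B T \<in> ?A" for T
    unfolding B_def by (rule inter) (use fin in auto)
  then have "B ` {T \<in> ?D. restr P T \<in> X} \<subseteq> ?A"
    by blast
  then have "\<Union>(B ` {T \<in> ?D. restr P T \<in> X}) \<in> ?A"
    using union[of "B ` {T \<in> ?D. restr P T \<in> X}"] finite_subset[OF _ fin] by simp
  moreover have "\<Union>(B ` {T \<in> ?D. restr P T \<in> X}) = {T \<in> ?D. restr P T \<in> X}"
    using B by auto
  ultimately have "{T \<in> ?D. restr P T \<in> X} \<in> ?A" by simp
  then obtain \<chi> where "vars \<chi> \<subseteq> P" "{T \<in> ?D. restr P T \<in> X} = {T \<in> ?D. \<chi> \<in> T}"
    by (elim imageE) simp
  then show thesis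
    using that by blast
qed

lemma kripke_depth_frame: "fin_depth L n \<noteq> {} \<Longrightarrow> kripke_frame (depth_frame L P n)"
  unfolding kripke_frame_def depth_frame_def by auto

text \<open>A class is recovered from the subfamily of the finitely many definable sets that contain
  a representative.\<close>

lemma finite_depth_frame:
  assumes "finite P"
  shows "finite (fst (depth_frame L P n))"
proof -
  define ext where "ext \<phi> = {T \<in> fin_depth L n. \<phi> \<in> T}" for \<phi>
  define A where "A = ext ` {\<phi>. vars \<phi> \<subseteq> P}"
  have "restr P T = {\<phi>. vars \<phi> \<subseteq> P \<and> ext \<phi> \<in> {a \<in> A. T \<in> a}}" if "T \<in> fin_depth L n" for T
  proof -
    have "ext \<phi> \<in> {a \<in> A. T \<in> a} \<longleftrightarrow> \<phi> \<in> T" if "vars \<phi> \<subseteq> P" for \<phi>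
      using that \<open>T \<in> fin_depth L n\<close> unfolding A_def by (simp add: ext_def)
    then show ?thesis
      unfolding restr_def by blast
  qed
  then have "restr P ` fin_depth L n \<subseteq> (\<lambda>B. {\<phi>. vars \<phi> \<subseteq> P \<and> ext \<phi> \<in> B}) ` Pow A"
    by blast
  moreover have "finite A"
    using finite_extensions[OF assms, of n] unfolding A_def ext_def .
  ultimately show ?thesis
    unfolding depth_frame_def fst_conv by (meson finite_Pow_iff finite_imageI finite_subset)
qed

text \<open>Truth lemma for the quotient, with \<open>\<sigma>\<close> naming the valuation.
  Instances under \<open>\<sigma>\<close> are over \<open>P\<close>, so their membership does not
  depend on the representative.\<close>

lemma sat_depth_frame:
  assumes \<sigma>: "\<And>p. vars (\<sigma> p) \<subseteq> P" "\<And>p T. T \<in> fin_depth L n \<Longrightarrow> \<sigma> p \<in> T \<longleftrightarrow> restr P T \<in> V p"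
    and T: "T \<in> fin_depth L n"
  shows "sat (depth_frame L P n) V (restr P T) \<phi> \<longleftrightarrow> subst \<sigma> \<phi> \<in> T"
  using T
proof (induction \<phi> arbitrary: T)
  case (Var p)
  then show ?case
    using \<sigma>(2) by simp
next
  case Bot
  then show ?case
    using mcs_D(3)[OF fin_depth_mcs] by simp
next
  case (Imp \<phi> \<psi>)
  then show ?case
    by (simp add: mcs_imp[OF L fin_depth_mcs])
next
  case (Box \<phi>)
  have "vars (\<box>(subst \<sigma> \<phi>)) \<subseteq> P"
    using vars_subst[OF \<sigma>(1)] by simp
  note inv = restr_eqD[OF _ this]
  show ?case
  proof
    assume sat: "sat (depth_frame L P n) V (restr P T) (\<box>\<phi>)"
    have "subst \<sigma> \<phi> \<in> T'" if "mcs L T'" "canon T T'" for T'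
    proof -
      have T': "T' \<in> fin_depth L n"
        using fin_depth_canon[OF Box.prems that] .
      then have "(restr P T, restr P T') \<in> snd (depth_frame L P n)"
        using Box.prems that(2) unfolding depth_frame_def by auto
      then show ?thesis
        using sat Box.IH[OF T'] by simp
    qed
    then show "subst \<sigma> (\<box>\<phi>) \<in> T"
      using mcs_box[OF L fin_depth_mcs[OF Box.prems]] by simp
  next
    assume box: "subst \<sigma> (\<box>\<phi>) \<in> T"
    have "sat (depth_frame L P n) V u \<phi>" if u: "(restr P T, u) \<in> snd (depth_frame L P n)" for u
    proof -
      \<comment> \<open>The edge may come from another representative \<open>S\<close> of the class;
        the boxed formula is over \<open>P\<close> and thus also lies in \<open>S\<close>.\<close>
      obtain S S' where S: "restr P S = restr P T" "u = restr P S'" "S' \<in> fin_depth L n" "canon S S'"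
        using u unfolding depth_frame_def by auto
      then have "subst \<sigma> \<phi> \<in> S'"
        using box inv[OF S(1)] unfolding canon_def by simp
      then show ?thesis
        using Box.IH[OF S(3)] S(2) by simp
    qed
    then show "sat (depth_frame L P n) V (restr P T) (\<box>\<phi>)" by simp
  qed
qed

text \<open>Each valuation on the quotient is named by a substitution, and the corresponding
  instance of a member of \<open>L\<close> is again in \<open>L\<close>, hence in every
  point.\<close>

lemma validates_depth_frame:
  assumes P: "finite P"
  shows "validates (depth_frame L P n) L"
  unfolding validates_def valid_on_def
proof (intro ballI allI impI)
  fix \<phi> V w assume \<phi>: "\<phi> \<in> L" and "w \<in> fst (depth_frame L P n)"
  then obtain T where T: "T \<in> fin_depth L n" "w = restr P T"
    unfolding depth_frame_def by auto
  have "\<exists>\<chi>. vars \<chi> \<subseteq> P \<and> (\<forall>T\<in>fin_depth L n. \<chi> \<in> T \<longleftrightarrow> restr P T \<in> V p)" for p :: nat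
    using restr_definable[OF P, of n "V p"] by metis
  then obtain \<sigma> where \<sigma>: "\<And>p. vars (\<sigma> p) \<subseteq> P" "\<And>p T. T \<in> fin_depth L n \<Longrightarrow> \<sigma> p \<in> T \<longleftrightarrow> restr P T \<in> V p"
    by metis
  have "subst \<sigma> \<phi> \<in> L"
    using L \<phi> unfolding normal_modal_logic_def closed_subst_def by simp
  then have "subst \<sigma> \<phi> \<in> T"
    using mcs_D(1)[OF fin_depth_mcs[OF T(1)]] by auto
  then show "sat (depth_frame L P n) V w \<phi>"
    unfolding T(2) using sat_depth_frame[OF \<sigma> T(1)] by simp
qed

lemma sat_depth_frame_self:
  assumes "vars \<phi> \<subseteq> P" "T \<in> fin_depth L n"
  shows "sat (depth_frame L P n) (\<lambda>p. {c. p \<in> P \<and> Var p \<in> c}) (restr P T) \<phi> \<longleftrightarrow> \<phi> \<in> T"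
proof -
  \<comment> \<open>Falsum outside \<open>P\<close> keeps all substituted formulas over
    \<open>P\<close>; on \<open>\<phi>\<close> the substitution is the identity.\<close>
  let ?\<sigma> = "\<lambda>p. if p \<in> P then Var p else \<^bold>\<bottom>"
  have "sat (depth_frame L P n) (\<lambda>p. {c. p \<in> P \<and> Var p \<in> c}) (restr P T) \<phi> \<longleftrightarrow> subst ?\<sigma> \<phi> \<in> T"
    by (rule sat_depth_frame) (use assms(2) mcs_D(3)[OF fin_depth_mcs] in \<open>auto simp: restr_def\<close>)
  also have "subst ?\<sigma> \<phi> = \<phi>"
    by (rule subst_ident) (use assms(1) in auto)
  finally show ?thesis .
qed

end

subsection \<open>Rigid gadget\<close>

primrec dle :: "nat \<Rightarrow> fm \<Rightarrow> fm" where
  "dle 0 \<phi> = \<phi>"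
| "dle (Suc k) \<phi> = dis \<phi> (dia (dle k \<phi>))"

abbreviation ble :: "nat \<Rightarrow> fm \<Rightarrow> fm" where "ble k \<phi> \<equiv> neg (dle k (neg \<phi>))"

definition reach :: "'w frame \<Rightarrow> nat \<Rightarrow> 'w \<Rightarrow> 'w \<Rightarrow> bool" where
  "reach F k w u \<longleftrightarrow> (\<exists>j\<le>k. (w, u) \<in> snd F ^^ j)"

lemma reach_0 [simp]: "reach F 0 w u \<longleftrightarrow> u = w"
  unfolding reach_def by auto

lemma reach_Suc: "reach F (Suc k) w u \<longleftrightarrow> u = w \<or> (\<exists>x. (w, x) \<in> snd F \<and> reach F k x u)"
proof
  assume "reach F (Suc k) w u"
  then obtain j where j: "j \<le> Suc k" "(w, u) \<in> snd F ^^ j"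
    unfolding reach_def by blast
  show "u = w \<or> (\<exists>x. (w, x) \<in> snd F \<and> reach F k x u)"
  proof (cases j)
    case (Suc i)
    then obtain x where "(w, x) \<in> snd F" "(x, u) \<in> snd F ^^ i"
      using j(2) relpow_Suc_D2 by metis
    then show ?thesis
      using j(1) Suc unfolding reach_def by auto
  qed (use j in simp)
next
  assume "u = w \<or> (\<exists>x. (w, x) \<in> snd F \<and> reach F k x u)"
  then show "reach F (Suc k) w u"
  proof
    assume "u = w"
    then have "(w, u) \<in> snd F ^^ 0" by simp
    then show ?thesis
      unfolding reach_def by blast
  next
    assume "\<exists>x. (w, x) \<in> snd F \<and> reach F k x u"
    then obtain x j where "(w, x) \<in> snd F" "(x, u) \<in> snd F ^^ j" "j \<le> k"
      unfolding reach_def by blast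
    then have "(w, u) \<in> snd F ^^ Suc j" "Suc j \<le> Suc k"
      by (simp_all add: relpow_Suc_I2 del: relpow.simps)
    then show ?thesis
      unfolding reach_def by blast
  qed
qed

lemma reach_mono: "reach F k w u \<Longrightarrow> k \<le> l \<Longrightarrow> reach F l w u"
  unfolding reach_def using le_trans by blast

lemma reach_trans:
  assumes "reach F k w u" "reach F l u x" "k + l \<le> m"
  shows "reach F m w x"
proof -
  obtain i j where "i \<le> k" "j \<le> l" "(w, u) \<in> snd F ^^ i" "(u, x) \<in> snd F ^^ j"
    using assms(1,2) unfolding reach_def by blast
  then have "(w, x) \<in> snd F ^^ (i + j)" "i + j \<le> m"
    using assms(3) by (auto simp: relpow_add)
  then show ?thesis
    unfolding reach_def by blast
qed

lemma reach_closed: "kripke_frame F \<Longrightarrow> reach F k w u \<Longrightarrow> w \<in> fst F \<Longrightarrow> u \<in> fst F"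
proof (induction k arbitrary: w)
  case (Suc k)
  then show ?case
    unfolding reach_Suc kripke_frame_def by blast
qed simp

lemma sat_dle [simp]: "sat F V w (dle k \<phi>) \<longleftrightarrow> (\<exists>u. reach F k w u \<and> sat F V u \<phi>)"
proof (induction k arbitrary: w)
  case (Suc k)
  show ?case
    unfolding reach_Suc dle.simps sat.simps Suc.IH by blast
qed simp

text \<open>If \<open>q\<close> holds at the hub \<open>U\<close> of the gadget below but neither at \<open>W\<close> nor at the chain, then
  \<open>chain q n\<close> defines the first \<open>n + 1\<close> elements of the chain.\<close>

primrec chain :: "fm \<Rightarrow> nat \<Rightarrow> fm" where
  "chain q 0 = con (\<box>q) (dia q)"
| "chain q (Suc n) = dis (chain q n) (con (dia (chain q n)) (dia q))"

abbreviation link :: "fm \<Rightarrow> nat \<Rightarrow> fm" where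
  "link q n \<equiv> con (chain q (Suc n)) (neg (chain q n))"

lemma chain_mono:
  assumes "sat F V w (chain q n)" "n \<le> m"
  shows "sat F V w (chain q m)"
  using assms(2)
proof (induction rule: dec_induct)
  case base
  show ?case by (fact assms(1))
next
  case (step m)
  then show ?case
    unfolding chain.simps(2) sat.simps(2,3) by blast
qed

text \<open>\<open>chain\<close> grows with \<open>n\<close>, so a fixed world satisfies
  \<open>link\<close> only at the stage, if any, just before it enters.\<close>

lemma eventually_no_link: "\<forall>\<^sub>F n in sequentially. \<not> sat F V w (link q n)"
proof (cases "\<exists>m. sat F V w (chain q m)")
  case True
  then obtain m where m: "sat F V w (chain q m)" by blast
  have "\<not> sat F V w (link q n)" if "m \<le> n" for n
    unfolding sat.simps(2,3) using chain_mono[OF m that] by iprover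
  then show ?thesis
    by (rule eventually_sequentiallyI)
next
  case False
  then have "\<not> sat F V w (link q n)" for n
    unfolding sat.simps(2,3) by iprover
  then show ?thesis by (rule always_eventually[OF allI])
qed

text \<open>Here finiteness excludes the gadget: finitely many worlds and terms each miss all large
  stages, so one \<open>n\<close> serves them all.\<close>

lemma finite_frame_no_link:
  assumes "kripke_frame F" "finite (fst F)" "w \<in> fst F"
  shows "\<exists>n. \<forall>q\<in>set qs. \<not> sat F V w (dle k (link q n))"
proof -
  have "\<forall>\<^sub>F n in sequentially. \<forall>u\<in>fst F. \<forall>q\<in>set qs. \<not> sat F V u (link q n)"
    by (intro eventually_ball_finite ballI assms(2) finite_set eventually_no_link)
  then obtain n where "\<forall>u\<in>fst F. \<forall>q\<in>set qs. \<not> sat F V u (link q n)"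
    unfolding eventually_sequentially by blast
  then have "\<not> sat F V w (dle k (link q n))" if "q \<in> set qs" for q
    using that reach_closed[OF assms(1) _ assms(3)] unfolding sat_dle by metis
  then show ?thesis by metis
qed

datatype 'a node = Base 'a | U | W | Num nat

text \<open>The gadget over a base frame \<open>(X, R)\<close> with exits \<open>Lf\<close>: the exits see \<open>U\<close>, \<open>U\<close> sees only \<open>W\<close>,
  \<open>W\<close> sees the base and the chain, and every element of the chain sees \<open>U\<close> and its predecessor.
  The reflexive elements of the chain code \<open>I\<close>, with a shift because \<open>Num 0\<close> must see \<open>U\<close> only.\<close>

fun gsucc :: "'a set \<Rightarrow> 'a set \<Rightarrow> ('a \<times> 'a) set \<Rightarrow> nat set \<Rightarrow> 'a node \<Rightarrow> 'a node set" where
  "gsucc X Lf R I (Base x) = Base ` (R `` {x}) \<union> (if x \<in> Lf then {U} else {})"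
| "gsucc X Lf R I U = {W}"
| "gsucc X Lf R I W = Base ` X \<union> range Num"
| "gsucc X Lf R I (Num 0) = {U}"
| "gsucc X Lf R I (Num (Suc n)) = {U, Num n} \<union> (if n \<in> I then {Num (Suc n)} else {})"

definition gadget_frame :: "'a set \<Rightarrow> 'a set \<Rightarrow> ('a \<times> 'a) set \<Rightarrow> nat set \<Rightarrow> 'a node frame" where
  "gadget_frame X Lf R I = (Base ` X \<union> {U, W} \<union> range Num, {(w, u). u \<in> gsucc X Lf R I w})"

definition diff :: "fm \<Rightarrow> fm" where "diff \<phi> = con (dia \<phi>) (dia (neg \<phi>))"

text \<open>Whenever \<open>\<phi>\<close> is not constant on the frame, one of these formulas
  separates \<open>U\<close> from \<open>W\<close> and the chain; \<open>hub_closed\<close> does so if the base has a dead end.\<close>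

definition hub_terms :: "fm \<Rightarrow> fm list" where
  "hub_terms \<phi> = [\<box>(diff \<phi>), \<box>(diff (diff \<phi>)), \<box>(neg \<phi>), \<box>\<phi>, \<box>(dia (neg \<phi>)), \<box>(dia \<phi>)]"

definition hub_closed :: fm where
  "hub_closed = con (\<box>(dia (\<box>\<^bold>\<bottom>))) (dia top)"

text \<open>At points that reach the whole gadget, \<open>only_W k (Var v)\<close> forces \<open>v\<close> to hold exactly at \<open>W\<close>.\<close>

definition only_W :: "nat \<Rightarrow> fm \<Rightarrow> fm" where
  "only_W k \<phi> = con (ble k (dis (\<box>\<phi>) (\<box>(neg \<phi>)))) (con (ble k (\<phi> \<^bold>\<rightarrow> \<box>(neg \<phi>))) (dle k \<phi>))"

text \<open>With \<open>\<phi>\<close> true exactly at \<open>W\<close>, \<open>q\<close> is true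
  exactly at \<open>U\<close> and \<open>link q i\<close> exactly at \<open>Num (Suc i)\<close>; the
  second conjunct then tests whether this point is reflexive.\<close>

definition loop :: "fm \<Rightarrow> nat \<Rightarrow> fm" where
  "loop \<phi> i = (let q = con (\<box>\<phi>) (dia \<phi>) in con (link q i) (dia (link q i)))"

text \<open>\<open>Tr\<close> is a part of the base from which an exit, hence the whole gadget, is
  reached in boundedly many steps; exits have no successors in the base and see only
  \<open>U\<close>.\<close>

locale gadget =
  fixes X Tr Lf :: "'a set" and R :: "('a \<times> 'a) set" and I :: "nat set" and d :: nat
  assumes R: "R \<subseteq> X \<times> X" and Tr: "Tr \<subseteq> X" and Lf: "Lf \<subseteq> X"
    and leaf: "l \<in> Lf \<Longrightarrow> (l, y) \<notin> R"
    and to_leaf: "x \<in> Tr \<Longrightarrow> \<exists>l\<in>Lf. \<exists>j\<le>d. (x, l) \<in> R ^^ j"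
begin

abbreviation F :: "'a node frame" where "F \<equiv> gadget_frame X Lf R I"

abbreviation alive :: "'a node set" where "alive \<equiv> Base ` Tr \<union> {U, W} \<union> range Num"

lemma kripke: "kripke_frame F"
proof -
  have "w \<in> fst F \<and> u \<in> fst F" if "u \<in> gsucc X Lf R I w" for w u
  proof (cases w)
    case (Base x)
    then show ?thesis
      using that R Lf unfolding gadget_frame_def by (auto split: if_splits)
  next
    case (Num n)
    then show ?thesis
      using that unfolding gadget_frame_def by (cases n) (auto split: if_splits)
  qed (use that in \<open>auto simp: gadget_frame_def\<close>)
  then have "snd F \<subseteq> fst F \<times> fst F"
    unfolding gadget_frame_def snd_conv by (auto simp only: mem_Sigma_iff)
  moreover have "fst F \<noteq> {}"
    unfolding gadget_frame_def by simp
  ultimately show ?thesis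
    unfolding kripke_frame_def by simp
qed

lemma snd_F: "(w, u) \<in> snd F \<longleftrightarrow> u \<in> gsucc X Lf R I w"
  unfolding gadget_frame_def by simp

lemma alive_worlds: "alive \<subseteq> fst F"
  using Tr unfolding gadget_frame_def by auto

lemma sat_Base: "sat F V (Base x) (\<box>\<phi>) \<longleftrightarrow>
    (\<forall>y. (x, y) \<in> R \<longrightarrow> sat F V (Base y) \<phi>) \<and> (x \<in> Lf \<longrightarrow> sat F V U \<phi>)"
  unfolding sat.simps(4) snd_F gsucc.simps by auto

lemma sat_U: "sat F V U (\<box>\<phi>) \<longleftrightarrow> sat F V W \<phi>"
  by (simp add: snd_F)

lemma sat_W: "sat F V W (\<box>\<phi>) \<longleftrightarrow> (\<forall>x\<in>X. sat F V (Base x) \<phi>) \<and> (\<forall>n. sat F V (Num n) \<phi>)"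
  unfolding sat.simps(4) snd_F gsucc.simps by auto

lemma sat_Num_0: "sat F V (Num 0) (\<box>\<phi>) \<longleftrightarrow> sat F V U \<phi>"
  by (simp add: snd_F)

lemma sat_Num_Suc: "sat F V (Num (Suc n)) (\<box>\<phi>) \<longleftrightarrow>
    sat F V U \<phi> \<and> sat F V (Num n) \<phi> \<and> (n \<in> I \<longrightarrow> sat F V (Num (Suc n)) \<phi>)"
  unfolding sat.simps(4) snd_F gsucc.simps by auto

lemmas sat_gadget = sat.simps(1-3) sat_Base sat_U sat_W sat_Num_0 sat_Num_Suc

lemma sat_Num_hub: "sat F V (Num n) (\<box>\<phi>) \<Longrightarrow> sat F V U \<phi>"
  using sat_Num_0[of V \<phi>] sat_Num_Suc[of V _ \<phi>] by (cases n) metis+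

text \<open>At most \<open>d\<close> steps to an exit, then one step each to \<open>U\<close>,
  \<open>W\<close> and the chain give the bound \<open>d + 3\<close>.\<close>

lemma reach_alive:
  assumes "w \<in> alive"
  shows "reach F (d + 3) w W" "reach F (d + 3) w (Num n)"
proof -
  have W: "reach F 0 W W" "reach F 1 W (Num n)"
    by (simp_all add: reach_Suc snd_F)
  have U: "reach F 1 U W" "reach F 2 U (Num n)"
    by (simp_all add: reach_Suc snd_F numeral_2_eq_2)
  have "\<exists>u\<in>{U, W}. reach F (d + 1) w u"
  proof -
    consider x where "x \<in> Tr" "w = Base x" | "w = U \<or> w = W" | m where "w = Num m"
      using assms by auto
    then show ?thesis
    proof cases
      case 1
      then obtain l j where l: "l \<in> Lf" "j \<le> d" "(x, l) \<in> R ^^ j"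
        using to_leaf by blast
      have "(Base x, Base y) \<in> snd F ^^ j" if "(x, y) \<in> R ^^ j" for y
        using that
      proof (induction j arbitrary: y)
        case (Suc j)
        then obtain z where "(x, z) \<in> R ^^ j" "(z, y) \<in> R" by auto
        then show ?case
          using Suc.IH[of z] by (auto simp: snd_F intro!: relcompI)
      qed simp
      then have "reach F d w (Base l)"
        using l 1(2) unfolding reach_def by auto
      moreover have "reach F 1 (Base l) U"
        using l(1) by (simp add: reach_Suc snd_F)
      ultimately have "reach F (d + 1) w U"
        by (rule reach_trans) simp
      then show ?thesis by simp
    next
      case 2
      then show ?thesis
        by (auto simp: reach_Suc)
    next
      case (3 m)
      have "reach F 1 w U"
        unfolding 3 by (cases m) (simp_all add: reach_Suc snd_F)
      then have "reach F (d + 1) w U"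
        by (rule reach_mono) simp
      then show ?thesis by simp
    qed
  qed
  then obtain u where u: "u \<in> {U, W}" "reach F (d + 1) w u" by blast
  have "reach F 2 u W" "reach F 2 u (Num n)"
    using u(1) reach_mono[OF W(1), of 2] reach_mono[OF W(2), of 2] reach_mono[OF U(1), of 2] U(2) by auto
  then show "reach F (d + 3) w W" "reach F (d + 3) w (Num n)"
    using reach_trans[OF u(2)] by simp_all
qed

section \<open>Formulas that separate the hub \<open>U\<close> from \<open>W\<close> and the
  chain\<close>

definition marks_hub :: "(nat \<Rightarrow> 'a node set) \<Rightarrow> fm \<Rightarrow> bool" where
  "marks_hub V q \<longleftrightarrow> sat F V U q \<and> \<not> sat F V W q \<and> (\<forall>n. \<not> sat F V (Num n) q)"

text \<open>\<open>Num 0\<close> sees only \<open>U\<close>, while every later element also sees its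
  predecessor, where \<open>q\<close> fails; so the chain is entered one element per stage. A
  reflexive loop never advances this, and \<open>U\<close> stays outside because \<open>q\<close>
  fails at its only successor \<open>W\<close>.\<close>

lemma marks_hub_chain:
  assumes "marks_hub V q"
  shows "sat F V (Num m) (chain q n) \<longleftrightarrow> m \<le> n" "\<not> sat F V U (chain q n)"
proof -
  have q: "sat F V U q" "\<not> sat F V W q" "\<not> sat F V (Num i) q" for i
    using assms unfolding marks_hub_def by simp_all
  have U: "\<not> sat F V U (chain q n)" for n
    using q(2) by (induction n) (simp_all only: chain.simps sat_gadget, simp_all)
  then show "\<not> sat F V U (chain q n)" .
  show "sat F V (Num m) (chain q n) \<longleftrightarrow> m \<le> n"
  proof (induction n arbitrary: m)
    case 0
    show ?case
      using q by (cases m) (simp_all only: chain.simps sat_gadget, simp_all)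
  next
    case (Suc n)
    show ?case
    proof (cases m)
      case 0
      then show ?thesis
        using Suc.IH[of 0] by (simp only: chain.simps sat_gadget) simp
    next
      case (Suc i)
      then show ?thesis
        using q(1) U[of n] Suc.IH[of i] Suc.IH[of "Suc i"] by (simp only: chain.simps sat_gadget) auto
    qed
  qed
qed

lemma marks_hub_link:
  assumes "marks_hub V q"
  shows "sat F V (Num (Suc n)) (link q n)"
  using marks_hub_chain(1)[OF assms, of "Suc n" "Suc n"] marks_hub_chain(1)[OF assms, of "Suc n" n]
  by (simp only: sat.simps) simp

lemma marks_hub_reach_link:
  assumes "marks_hub V q" "w \<in> alive"
  shows "sat F V w (dle (d + 3) (link q n))"
  unfolding sat_dle using marks_hub_link[OF assms(1)] reach_alive(2)[OF assms(2)] by blast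

text \<open>\<open>U\<close> sees only \<open>W\<close>, which sees the dead end \<open>z\<close>.
  \<open>W\<close> fails the formula because of \<open>z\<close>, and the chain because it sees
  \<open>U\<close>, whose sole successor is not a dead end.\<close>

lemma marks_hub_closed:
  assumes "z \<in> X" "z \<notin> Lf" "\<And>y. (z, y) \<notin> R"
  shows "marks_hub V hub_closed"
proof -
  have z: "sat F V (Base z) (\<box>\<^bold>\<bottom>)" "\<not> sat F V (Base z) (dia (\<box>\<^bold>\<bottom>))"
    using assms(2,3) by (simp_all only: sat_gadget) simp_all
  have "\<not> sat F V U (dia (\<box>\<^bold>\<bottom>))"
    by (simp only: sat_gadget) simp
  then have "\<not> sat F V (Num n) (\<box>(dia (\<box>\<^bold>\<bottom>)))" for n
    using sat_Num_hub by blast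
  moreover have "sat F V W (dia (\<box>\<^bold>\<bottom>))"
    using z(1) assms(1) sat_W[of V "neg (\<box>\<^bold>\<bottom>)"] by auto
  then have "sat F V U hub_closed"
    unfolding hub_closed_def by (simp only: sat_U sat.simps(2,3)) simp
  moreover have "\<not> sat F V W hub_closed"
    using z(2) assms(1) sat_W[of V "dia (\<box>\<^bold>\<bottom>)"] unfolding hub_closed_def by auto
  ultimately show ?thesis
    unfolding marks_hub_def hub_closed_def by (simp only: sat.simps(2,3)) simp
qed

text \<open>\<open>W\<close> sees both values of \<open>\<phi>\<close> on the chain, whereas
  \<open>U\<close> and \<open>Num 0\<close> have a single successor and refute
  \<open>diff \<phi>\<close>. So the box holds at \<open>U\<close> but fails at \<open>W\<close>,
  which sees \<open>Num 0\<close>, and on the chain, which sees \<open>U\<close>.\<close>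

lemma marks_hub_diff:
  assumes "sat F V (Num m) \<phi>" "\<not> sat F V (Num n) \<phi>"
  shows "marks_hub V (\<box>(diff \<phi>))"
proof -
  have "\<not> sat F V U (diff \<phi>)" "\<not> sat F V (Num 0) (diff \<phi>)" "sat F V W (diff \<phi>)"
    using assms unfolding diff_def by (simp_all only: sat_gadget) auto
  then show ?thesis
    using sat_Num_hub unfolding marks_hub_def sat_U sat_W by blast
qed

text \<open>If \<open>\<phi>\<close> fails at \<open>U\<close>, \<open>diff \<phi>\<close> tells
  \<open>Num (Suc 0)\<close> from \<open>Num 0\<close>. If it holds at \<open>U\<close> and fails at
  \<open>W\<close>, only \<open>U\<close> among the gadget points sees nothing but failures. If it
  fails only in the base, \<open>W\<close> sees a failure and \<open>U\<close> and
  \<open>Num 0\<close> do not.\<close>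

lemma marks_hub_const:
  assumes N: "\<And>n. sat F V (Num n) \<phi>" and w: "w \<in> fst F" "\<not> sat F V w \<phi>"
  shows "marks_hub V (\<box>(diff (diff \<phi>))) \<or> marks_hub V (\<box>(neg \<phi>)) \<or> marks_hub V (\<box>(dia (neg \<phi>)))"
proof (cases "sat F V U \<phi>")
  case False
  then have "sat F V (Num (Suc 0)) (diff \<phi>)" "\<not> sat F V (Num 0) (diff \<phi>)"
    using N unfolding diff_def by (simp_all only: sat_gadget) auto
  then show ?thesis
    using marks_hub_diff by blast
next
  case U: True
  show ?thesis
  proof (cases "sat F V W \<phi>")
    case False
    then have "marks_hub V (\<box>(neg \<phi>))"
      using U N sat_Num_hub[of V _ "neg \<phi>"] unfolding marks_hub_def sat_U sat_W by auto
    then show ?thesis by blast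
  next
    case True
    then obtain x where "x \<in> X" "\<not> sat F V (Base x) \<phi>"
      using w N U unfolding gadget_frame_def by auto
    then have "sat F V W (dia (neg \<phi>))"
      by (simp only: sat_gadget) auto
    moreover have "\<not> sat F V U (dia (neg \<phi>))" "\<not> sat F V (Num 0) (dia (neg \<phi>))"
      using True U by (simp_all only: sat_gadget) auto
    ultimately have "marks_hub V (\<box>(dia (neg \<phi>)))"
      using sat_Num_hub unfolding marks_hub_def sat_U sat_W by blast
    then show ?thesis by blast
  qed
qed

lemma marks_hub_terms:
  assumes "w \<in> fst F" "sat F V w \<phi>" "u \<in> fst F" "\<not> sat F V u \<phi>"
  shows "\<exists>q\<in>set (hub_terms \<phi>). marks_hub V q"
proof -
  consider m n where "sat F V (Num m) \<phi>" "\<not> sat F V (Num n) \<phi>"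
    | "\<And>n. sat F V (Num n) \<phi>" | "\<And>n. sat F V (Num n) (neg \<phi>)"
    by auto
  then show ?thesis
  proof cases
    case 1
    then show ?thesis
      using marks_hub_diff unfolding hub_terms_def by auto
  next
    case 2
    show ?thesis
      using marks_hub_const[OF 2 assms(3,4)] unfolding hub_terms_def by auto
  next
    case 3
    have "\<not> sat F V w (neg \<phi>)"
      using assms(2) by simp
    then have "marks_hub V (\<box>(diff (diff (neg \<phi>)))) \<or> marks_hub V (\<box>(neg (neg \<phi>))) \<or> marks_hub V (\<box>(dia (neg (neg \<phi>))))"
      using marks_hub_const[OF 3 assms(1)] by blast
    \<comment> \<open>\<open>diff\<close> is insensitive to negation, which brings the term for the
      negated formula back into the list.\<close>
    moreover have "sat F V x (diff (diff (neg \<phi>))) \<longleftrightarrow> sat F V x (diff (diff \<phi>))" for x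
      unfolding diff_def by auto
    ultimately show ?thesis
      unfolding hub_terms_def marks_hub_def by auto
  qed
qed

text \<open>If all successors of \<open>W\<close> satisfied \<open>\<phi>\<close>, so would
  \<open>Num (Suc 0)\<close> and its successor \<open>Num 0\<close>, against the second conjunct. So
  \<open>\<phi>\<close> fails on base and chain and, being constant on the successors of
  \<open>Num (Suc 0)\<close>, also at \<open>U\<close>; the point promised by the last conjunct must
  be \<open>W\<close>.\<close>

lemma only_W_sat:
  assumes w: "w \<in> alive" and sat: "sat F V w (only_W (d + 3) \<phi>)"
  shows "marks_hub V (con (\<box>\<phi>) (dia \<phi>))"
proof -
  have all: "sat F V x (\<box>\<phi>) \<or> sat F V x (\<box>(neg \<phi>))" "sat F V x \<phi> \<Longrightarrow> sat F V x (\<box>(neg \<phi>))"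
    if "reach F (d + 3) w x" for x
    using sat that unfolding only_W_def sat.simps(2,3) sat_dle by blast+
  obtain x where x: "reach F (d + 3) w x" "sat F V x \<phi>"
    using sat unfolding only_W_def sat.simps(2,3) sat_dle by blast
  have "x \<in> fst F"
    using reach_closed[OF kripke x(1)] w alive_worlds by blast
  have "\<not> sat F V W (\<box>\<phi>)"
    using all(2)[OF reach_alive(2)[OF w, of "Suc 0"]] unfolding sat_W sat_Num_Suc by auto
  then have W: "sat F V W (\<box>(neg \<phi>))"
    using all(1)[OF reach_alive(1)[OF w]] by blast
  then have "\<not> sat F V (Num 0) \<phi>"
    unfolding sat_W by simp
  then have "\<not> sat F V U \<phi>"
    using all(1)[OF reach_alive(2)[OF w, of "Suc 0"]] unfolding sat_Num_Suc by auto
  then have "x = W"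
    using W x(2) \<open>x \<in> fst F\<close> unfolding sat_W by (auto simp: gadget_frame_def)
  then have "sat F V W \<phi>"
    using x(2) by simp
  moreover have "\<not> sat F V (Num n) (\<box>\<phi>)" for n
    using \<open>\<not> sat F V U \<phi>\<close> sat_Num_hub by blast
  ultimately show ?thesis
    using \<open>\<not> sat F V W (\<box>\<phi>)\<close> unfolding marks_hub_def by (simp only: sat.simps(2,3) sat_U) simp
qed

lemma only_W_loop:
  assumes "w \<in> alive" "sat F V w (only_W (d + 3) \<phi>)" "i \<in> I"
  shows "sat F V w (dle (d + 3) (loop \<phi> i))"
proof -
  have "sat F V (Num (Suc i)) (link (con (\<box>\<phi>) (dia \<phi>)) i)"
    using marks_hub_link[OF only_W_sat[OF assms(1,2)]] .
  then have "sat F V (Num (Suc i)) (loop \<phi> i)"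
    using assms(3) unfolding loop_def Let_def sat.simps(2,3) sat_Num_Suc by blast
  then show ?thesis
    unfolding sat_dle using reach_alive(2)[OF assms(1)] by blast
qed

text \<open>This valuation makes \<open>link q i\<close> true at no world but
  \<open>Num (Suc i)\<close>, which without its loop sees just \<open>U\<close> and
  \<open>Num i\<close>.\<close>

lemma only_W_no_loop:
  assumes w: "w \<in> alive" and V: "V v = {W}" and i: "i \<notin> I"
  shows "sat F V w (only_W (d + 3) (Var v))" "\<not> sat F V w (dle (d + 3) (loop (Var v) i))"
proof -
  define q where "q = con (\<box>(Var v)) (dia (Var v))"
  have v: "sat F V x (Var v) \<longleftrightarrow> x = W" for x
    using V by simp
  \<comment> \<open>\<open>U\<close> is the only point that sees \<open>W\<close>.\<close>
  have only: "sat F V x (\<box>(neg (Var v)))" if "x \<noteq> U" for x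
    using that by (cases "(X, Lf, R, I, x)" rule: gsucc.cases) (auto simp: snd_F V)
  have "sat F V U (\<box>(Var v))"
    by (simp add: sat_U v del: sat.simps)
  then have "sat F V x (dis (\<box>(Var v)) (\<box>(neg (Var v))))" "sat F V x (Var v \<^bold>\<rightarrow> \<box>(neg (Var v)))" for x
    using only[of x] v[of x] unfolding sat.simps(2,3) by blast+
  moreover have "\<exists>x. reach F (d + 3) w x \<and> sat F V x (Var v)"
    using reach_alive(1)[OF w] v by blast
  ultimately show "sat F V w (only_W (d + 3) (Var v))"
    unfolding only_W_def sat.simps(2,3) sat_dle by blast
  have sat_q: "sat F V x q \<longleftrightarrow> x = U" for x
  proof (cases "x = U")
    case True
    show ?thesis
      unfolding True q_def sat.simps(2,3) sat_U v by simp
  next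
    case False
    then show ?thesis
      using only[of x] unfolding q_def sat.simps(2,3) by blast
  qed
  have hub: "marks_hub V q"
    unfolding marks_hub_def sat_q by simp
  have chain_q: "sat F V x (dia q)" if "sat F V x (chain q n)" for x n
    using that by (induction n) (unfold chain.simps sat.simps(2,3), blast+)
  have link: "x = Num (Suc i)" if "x \<in> fst F" "sat F V x (link q i)" for x
  proof -
    have x: "sat F V x (chain q (Suc i))" "\<not> sat F V x (chain q i)"
      using that(2) unfolding sat.simps(2,3) by blast+
    have dia: "sat F V x (dia q)"
      using chain_q[OF x(1)] .
    consider y where "x = Base y" | "x = U" | "x = W" | m where "x = Num m"
      by (cases x)
    then show ?thesis
    proof cases
      \<comment> \<open>A base point that sees \<open>q\<close> is an exit, sees nothing but
        \<open>U\<close>, and so already satisfies stage \<open>0\<close> of the chain.\<close>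
      case (1 y)
      then have "y \<in> Lf"
        using dia unfolding 1 sat.simps(2,3) sat_Base sat_q by blast
      then have "sat F V x (\<box>q)"
        using leaf unfolding 1 sat_Base sat_q by blast
      then have "sat F V x (chain q 0)"
        using dia unfolding chain.simps sat.simps(2,3) by blast
      then show ?thesis
        using x(2) chain_mono[of F V x q 0 i] by simp
    next
      case 2
      then show ?thesis
        using marks_hub_chain(2)[OF hub] x(1) by blast
    next
      case 3
      then show ?thesis
        using dia unfolding 3 sat.simps(2,3) sat_W sat_q by blast
    next
      case (4 m)
      then show ?thesis
        using x unfolding 4 marks_hub_chain(1)[OF hub] by simp
    qed
  qed
  have "\<not> sat F V x (loop (Var v) i)" if "x \<in> fst F" for x
  proof
    assume "sat F V x (loop (Var v) i)"
    then have *: "sat F V x (link q i)" "sat F V x (dia (link q i))"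
      unfolding loop_def Let_def q_def[symmetric] sat.simps(2,3) by blast+
    then have "x = Num (Suc i)"
      using link that by blast
    then have "sat F V U (link q i) \<or> sat F V (Num i) (link q i)"
      using *(2) i unfolding \<open>x = Num (Suc i)\<close> sat.simps(2,3) sat_Num_Suc by blast
    moreover have "U \<in> fst F" "Num i \<in> fst F"
      unfolding gadget_frame_def by simp_all
    ultimately show False
      using link by fastforce
  qed
  then show "\<not> sat F V w (dle (d + 3) (loop (Var v) i))"
    unfolding sat_dle using reach_closed[OF kripke] w alive_worlds by blast
qed

end

subsection \<open>The logic of the finite frames\<close>

text \<open>The logic \<open>M\<close> of the opening overview; if there are no finite frames it is
  the set of all formulas.\<close>

definition fin_logic :: "fm set \<Rightarrow> fm set" where
  "fin_logic L = \<Inter>(log ` Fin L)"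

abbreviation irr :: "nat frame" where "irr \<equiv> ({0}, {})"
abbreviation refl :: "nat frame" where "refl \<equiv> ({0}, {(0, 0)})"

lemma validates_log: "validates F L \<longleftrightarrow> L \<subseteq> log F"
  unfolding validates_def log_def by blast

lemma normal_fin_logic: "normal_modal_logic (fin_logic L)"
  unfolding fin_logic_def using normal_log by (intro normal_Inter) (auto simp: Fin_def)

lemma fin_logic_superset: "L \<subseteq> fin_logic L"
  unfolding fin_logic_def Fin_def validates_log by blast

lemma Fin_antimono: "L \<subseteq> L' \<Longrightarrow> Fin L' \<subseteq> Fin L"
  unfolding Fin_def validates_def by blast

lemma Fin_fin_logic: "Fin (fin_logic L) = Fin L"
proof
  show "Fin (fin_logic L) \<subseteq> Fin L"
    using Fin_antimono[OF fin_logic_superset] .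
  show "Fin L \<subseteq> Fin (fin_logic L)"
    unfolding Fin_def validates_log fin_logic_def by blast
qed

lemma fin_logic_valid:
  fixes F :: "'w frame"
  assumes "kripke_frame F" "finite (fst F)" "validates F L" "\<mu> \<in> fin_logic L"
  shows "valid_on F \<mu>"
  using Fin_eq_imp_agree[OF Fin_fin_logic[of L] assms(1,2)] assms(3,4) unfolding validates_def by blast

text \<open>A dead end generates a one-point irreflexive subframe.\<close>

lemma dead_end_irr:
  assumes "kripke_frame F" "validates F L" "w \<in> fst F" "\<And>u. (w, u) \<notin> snd F"
  shows "irr \<in> Fin L"
proof -
  have "valid_on irr \<phi>" if "\<phi> \<in> L" for \<phi>
    unfolding valid_on_def
  proof (intro allI impI ballI)
    fix V :: "nat \<Rightarrow> nat set" and x assume "x \<in> fst irr"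
    have "sat F (\<lambda>p. if 0 \<in> V p then {w} else {}) w \<phi>"
      using valid_onD[OF assms(1) _ assms(3)] assms(2) that unfolding validates_def by blast
    moreover have "sat F (\<lambda>p. if 0 \<in> V p then {w} else {}) w \<phi> \<longleftrightarrow> sat irr V 0 \<phi>"
      by (rule sat_morphism[where f = "\<lambda>_. w" and A = "{0}"]) (use assms(4) in auto)
    ultimately show "sat irr V x \<phi>"
      using \<open>x \<in> fst irr\<close> by simp
  qed
  then show ?thesis
    unfolding Fin_def validates_def kripke_frame_def by simp
qed

subsection \<open>The base frame\<close>

text \<open>\<open>Shal\<close> carries the classes of points of finite depth. \<open>Dead\<close>
  is a dead end seen from \<open>W\<close> alone, which makes \<open>hub_closed\<close> a marker of
  \<open>U\<close>.\<close>

datatype base = Deep nat "fm set" | Shal "fm set" | Dead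

locale incomplete =
  fixes L :: "fm set" and \<phi> :: fm
  assumes L: "normal_modal_logic L" and \<phi>_fin: "\<phi> \<in> fin_logic L" and \<phi>_notin: "\<phi> \<notin> L"
begin

abbreviation d :: nat where "d \<equiv> md \<phi>"
abbreviation Q :: "nat \<Rightarrow> fm set frame" where "Q n \<equiv> depth_frame L (vars \<phi>) n"

text \<open>\<open>Deep i T\<close> is a point at distance \<open>i\<close> from the root of the unravelling; the condition on its depth
  guarantees that it has a path to a leaf at distance \<open>d\<close>.\<close>

definition deep :: "base set" where
  "deep = {Deep i T | i T. i \<le> d \<and> mcs L T \<and> T \<notin> fin_depth L (d - i)}"

definition leaves :: "base set" where
  "leaves = {Deep d T | T. mcs L T}"

definition base :: "base set" where
  "base = deep \<union> Shal ` fst (Q d) \<union> (if irr \<in> Fin L then {Dead} else {})"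

text \<open>Before distance \<open>d\<close>, every canonical successor is represented by a
  \<open>Deep\<close> copy, a \<open>Shal\<close> class or both. Leaves get no successors inside the
  base.\<close>

definition edges :: "(base \<times> base) set" where
  "edges = {(Deep i T, Deep (Suc i) T') | i T T'. Deep i T \<in> deep \<and> Deep (Suc i) T' \<in> deep \<and> canon T T'}
    \<union> {(Deep i T, Shal (restr (vars \<phi>) T')) | i T T'. Deep i T \<in> deep \<and> i < d \<and> T' \<in> fin_depth L d \<and> canon T T'}
    \<union> map_prod Shal Shal ` snd (Q d)"

abbreviation frame :: "nat set \<Rightarrow> base node frame" where
  "frame I \<equiv> gadget_frame base leaves edges I"

definition span_logic :: "nat set \<Rightarrow> fm set" where
  "span_logic I = fin_logic L \<inter> log (frame I)"

lemma Deep_deep: "Deep i T \<in> deep \<longleftrightarrow> i \<le> d \<and> mcs L T \<and> T \<notin> fin_depth L (d - i)"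
  unfolding deep_def by simp

lemma Q_closed: "(c, c') \<in> snd (Q n) \<Longrightarrow> c \<in> fst (Q n) \<and> c' \<in> fst (Q n)"
  unfolding depth_frame_def by auto

text \<open>A point outside level \<open>k + 1\<close> has a successor outside level
  \<open>k\<close>, so the path can be continued to distance \<open>d\<close>.\<close>

lemma Deep_to_leaf: "Deep i T \<in> deep \<Longrightarrow> \<exists>l\<in>leaves. (Deep i T, l) \<in> edges ^^ (d - i)"
proof (induction "d - i" arbitrary: i T)
  case 0
  then show ?case
    unfolding Deep_deep leaves_def by auto
next
  case (Suc k)
  have "mcs L T" "T \<notin> fin_depth L (Suc k)"
    using Suc.prems Suc.hyps(2) unfolding Deep_deep by simp_all
  then obtain T' where T': "mcs L T'" "canon T T'" "T' \<notin> fin_depth L k"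
    unfolding fin_depth_Suc[OF L] by blast
  have k: "k = d - Suc i" "Suc i \<le> d"
    using Suc.hyps(2) by simp_all
  then have deep: "Deep (Suc i) T' \<in> deep"
    using T' unfolding Deep_deep by simp
  then obtain l where "l \<in> leaves" "(Deep (Suc i) T', l) \<in> edges ^^ k"
    using Suc.hyps(1)[OF k(1)] k(1) by auto
  moreover have "(Deep i T, Deep (Suc i) T') \<in> edges"
    using Suc.prems deep T'(2) unfolding edges_def by blast
  ultimately show ?case
    unfolding Suc.hyps(2)[symmetric] using relpow_Suc_I2 by metis
qed

sublocale gadget base deep leaves edges I d for I
proof
  show "edges \<subseteq> base \<times> base"
    unfolding edges_def base_def using Q_closed by (fastforce simp: depth_frame_def)
  show "deep \<subseteq> base"
    unfolding base_def by blast
  \<comment> \<open>At distance \<open>d\<close> the depth condition of \<open>deep\<close> refers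
    to the empty level \<open>0\<close>, so every leaf is in \<open>deep\<close>.\<close>
  show "leaves \<subseteq> base"
    unfolding leaves_def base_def deep_def using fin_depth_0[OF L] by auto
  show "(l, y) \<notin> edges" if "l \<in> leaves" for l y
    using that unfolding leaves_def edges_def by (auto simp: Deep_deep)
  show "\<exists>l\<in>leaves. \<exists>j\<le>d. (x, l) \<in> edges ^^ j" if "x \<in> deep" for x
  proof -
    obtain i T where "x = Deep i T"
      using \<open>x \<in> deep\<close> unfolding deep_def by blast
    then show ?thesis
      using Deep_to_leaf that diff_le_self by blast
  qed
qed

lemma edge_Shal: "(Shal c, y) \<in> edges \<longleftrightarrow> (\<exists>c'. y = Shal c' \<and> (c, c') \<in> snd (Q d))"
  unfolding edges_def by auto

lemma edge_Dead: "(Dead, y) \<notin> edges"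
  unfolding edges_def by auto

lemma not_leaf: "Shal c \<notin> leaves" "Dead \<notin> leaves" "Deep i T \<in> leaves \<Longrightarrow> i = d"
  unfolding leaves_def by simp_all

lemma sat_Shal:
  assumes "c \<in> fst (Q d)" "\<And>c p. Base (Shal c) \<in> V p \<longleftrightarrow> c \<in> V' p"
  shows "sat (frame I) V (Base (Shal c)) \<mu> \<longleftrightarrow> sat (Q d) V' c \<mu>"
proof -
  have succ: "(Base (Shal c), u) \<in> snd (frame I) \<longleftrightarrow> (\<exists>x\<in>fst (Q d). u = Base (Shal x) \<and> (c, x) \<in> snd (Q d))" for c u
    unfolding snd_F gsucc.simps using Q_closed by (auto simp: edge_Shal not_leaf)
  show ?thesis
    by (rule sat_morphism[where f = "\<lambda>c. Base (Shal c)" and A = "fst (Q d)"])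
      (use assms succ Q_closed in blast)+
qed

lemma Q_valid:
  assumes "c \<in> fst (Q n)" "\<mu> \<in> fin_logic L"
  shows "sat (Q n) V c \<mu>"
proof -
  have "fin_depth L n \<noteq> {}"
    using assms(1) unfolding depth_frame_def by auto
  note kripke = kripke_depth_frame[OF L this]
  have "valid_on (Q n) \<mu>"
    using fin_logic_valid[OF kripke finite_depth_frame[OF L finite_vars] validates_depth_frame[OF L finite_vars] assms(2)] .
  then show ?thesis
    using valid_onD[OF kripke _ assms(1)] by blast
qed

text \<open>These points lie in successor-closed copies of \<open>Q d\<close> or \<open>irr\<close>,
  which are finite frames for \<open>L\<close>.\<close>

lemma not_alive_valid:
  assumes "w \<in> fst (frame I)" "w \<notin> alive" "\<mu> \<in> fin_logic L"
  shows "sat (frame I) V w \<mu>"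
proof -
  consider c where "c \<in> fst (Q d)" "w = Base (Shal c)" | "irr \<in> Fin L" "w = Base Dead"
    using assms(1,2) unfolding gadget_frame_def base_def by (auto split: if_splits)
  then show ?thesis
  proof cases
    case 1
    show ?thesis
      unfolding 1(2) using Q_valid[OF 1(1) assms(3)] sat_Shal[OF 1(1), of V "\<lambda>p. {c. Base (Shal c) \<in> V p}"] by blast
  next
    case 2
    have "sat irr (\<lambda>p. if Base Dead \<in> V p then {0} else {}) 0 \<mu>"
      using fin_logic_valid[of irr L \<mu>] 2(1) assms(3) by (intro valid_onD) (auto simp: Fin_def)
    moreover have "(Base Dead, u) \<notin> snd (frame I)" for u
      unfolding snd_F gsucc.simps by (auto simp: edge_Dead not_leaf)
    then have "sat (frame I) V (Base Dead) \<mu> \<longleftrightarrow> sat irr (\<lambda>p. if Base Dead \<in> V p then {0} else {}) 0 \<mu>"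
      by (intro sat_morphism[where f = "\<lambda>_. Base Dead" and A = "{0}"]) auto
    ultimately show ?thesis
      unfolding 2(2) by blast
  qed
qed

text \<open>\<open>\<mu>\<close> takes care of the finite frames and of the points that are not
  alive, \<open>\<psi>\<close> of the alive ones.\<close>

lemma dis_span_logic:
  assumes "\<mu> \<in> fin_logic L" "\<And>V w. w \<in> alive \<Longrightarrow> sat (frame I) V w \<psi>"
  shows "dis \<mu> \<psi> \<in> span_logic I"
proof -
  have "sat (frame I) V w (dis \<mu> \<psi>)" if "w \<in> fst (frame I)" for V w
    using not_alive_valid[OF that _ assms(1)] assms(2)[of w V] unfolding sat.simps(2,3) by (cases "w \<in> alive") simp_all
  then have "dis \<mu> \<psi> \<in> log (frame I)"
    unfolding log_def valid_on_def by blast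
  moreover have "dis \<mu> \<psi> \<in> fin_logic L"
    using assms(1) unfolding fin_logic_def log_def valid_on_def by simp
  ultimately show ?thesis
    unfolding span_logic_def by blast
qed

lemma normal_span_logic: "normal_modal_logic (span_logic I)"
  unfolding span_logic_def using normal_Int[OF normal_fin_logic normal_log[OF kripke]] .

end

context incomplete
begin

subsection \<open>Finite frames of the logics in the span\<close>

text \<open>\<open>Dead\<close> lets \<open>hub_closed\<close> mark \<open>U\<close> under every
  valuation, so for each \<open>n\<close> the logic contains the disjunction of \<open>\<mu>\<close>
  with reachability of link \<open>n\<close>. A world of a finite frame misses some link and must
  satisfy \<open>\<mu>\<close>.\<close>

lemma Fin_span_irr:
  assumes irr: "irr \<in> Fin L"
  shows "Fin (span_logic I) \<subseteq> Fin (fin_logic L)"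
proof
  fix G assume "G \<in> Fin (span_logic I)"
  then have G: "kripke_frame G" "finite (fst G)" "validates G (span_logic I)"
    unfolding Fin_def by simp_all
  have "valid_on G \<mu>" if \<mu>: "\<mu> \<in> fin_logic L" for \<mu>
    unfolding valid_on_def
  proof (intro allI impI ballI)
    fix V w assume w: "w \<in> fst G"
    have "Dead \<in> base"
      using irr unfolding base_def by simp
    then have "marks_hub J V' hub_closed" for J V'
      using marks_hub_closed edge_Dead not_leaf(2) by blast
    then have "dis \<mu> (dle (d + 3) (link hub_closed n)) \<in> span_logic I" for n
      using marks_hub_reach_link by (intro dis_span_logic[OF \<mu>]) blast
    then have "sat G V w (dis \<mu> (dle (d + 3) (link hub_closed n)))" for n
      using valid_onD[OF G(1) _ w] G(3) unfolding validates_def by blast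
    moreover obtain n where "\<forall>q\<in>set [hub_closed]. \<not> sat G V w (dle (d + 3) (link q n))"
      using finite_frame_no_link[OF G(1,2) w] ..
    then have "\<not> sat G V w (dle (d + 3) (link hub_closed n))"
      by (rule bspec) simp
    ultimately show "sat G V w \<mu>"
      unfolding sat.simps(2,3) by blast
  qed
  then show "G \<in> Fin (fin_logic L)"
    using G unfolding Fin_def validates_def by simp
qed

context
  assumes no_irr: "irr \<notin> Fin L"
begin

text \<open>Points on a lowest nonempty level would have no successors and put a dead end into a
  frame for \<open>L\<close>.\<close>

lemma fin_depth_empty: "fin_depth L n = {}"
proof (induction n)
  case (Suc n)
  have no_edge: "(c, c') \<notin> snd (Q (Suc n))" for c c'
    using Suc.IH fin_depth_Suc[OF L] fin_depth_mcs[OF L] unfolding depth_frame_def by auto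
  show ?case
  proof (rule ccontr)
    assume nonempty: "fin_depth L (Suc n) \<noteq> {}"
    then obtain c where "c \<in> fst (Q (Suc n))"
      unfolding depth_frame_def by auto
    then have "irr \<in> Fin L"
      by (rule dead_end_irr[OF kripke_depth_frame[OF L nonempty] validates_depth_frame[OF L finite_vars] _ no_edge])
    then show False
      using no_irr by contradiction
  qed
qed (rule fin_depth_0[OF L])

lemma base_deep: "base = deep"
  unfolding base_def depth_frame_def fin_depth_empty using no_irr by simp

lemma dia_top: "dia top \<in> span_logic I"
proof -
  have "dia top \<in> log G" if "G \<in> Fin L" for G
  proof -
    have "\<exists>u. (w, u) \<in> snd G" if "w \<in> fst G" for w
      using dead_end_irr[of G L w] \<open>G \<in> Fin L\<close> that no_irr unfolding Fin_def by blast
    then show ?thesis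
      unfolding log_def valid_on_def by simp
  qed
  moreover have "\<exists>u. (w, u) \<in> snd (frame I)" if w: "w \<in> fst (frame I)" for w
  proof (cases w)
    case (Base x)
    then have "x \<in> deep"
      using w base_deep unfolding gadget_frame_def by auto
    then obtain l j where "l \<in> leaves" "(x, l) \<in> edges ^^ j"
      using to_leaf by blast
    then have "x \<in> leaves \<or> (\<exists>y. (x, y) \<in> edges)"
      by (cases j) (auto dest: relpow_Suc_D2 simp del: relpow.simps(2))
    then show ?thesis
      unfolding snd_F Base gsucc.simps by auto
  next
    case (Num n)
    then show ?thesis
      unfolding snd_F by (cases n) auto
  qed (auto simp: snd_F)
  then have "dia top \<in> log (frame I)"
    unfolding log_def valid_on_def by simp
  ultimately show ?thesis
    unfolding span_logic_def fin_logic_def by blast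
qed

text \<open>Makinson's argument: every canonical point has a successor, so instances by truth
  constants have the same status at all points, and boxes act as at a single reflexive
  point.\<close>

lemma refl_Fin: "refl \<in> Fin L"
proof -
  have "sat refl V 0 \<psi>" if \<psi>: "\<psi> \<in> L" for V \<psi>
  proof -
    define \<sigma> where "\<sigma> p = (if 0 \<in> V p then top else \<^bold>\<bottom>)" for p :: nat
    have subst: "mcs L T \<Longrightarrow> subst \<sigma> \<chi> \<in> T \<longleftrightarrow> sat refl V 0 \<chi>" for T \<chi>
    proof (induction \<chi> arbitrary: T)
      case (Var p)
      then show ?case
        using mcs_D(3)[OF Var.prems] by (simp add: \<sigma>_def mcs_imp[OF L])
    next
      case Bot
      then show ?case
        using mcs_D(3)[OF Bot.prems] by simp
    next
      case (Imp \<chi> \<chi>')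
      then show ?case
        by (simp add: mcs_imp[OF L])
    next
      case (Box \<chi>)
      have "\<exists>T'. mcs L T' \<and> canon T T'"
        using fin_depth_Suc[OF L, of T 0] fin_depth_empty Box.prems by blast
      then show ?case
        using Box.IH by (auto simp: mcs_box[OF L Box.prems])
    qed
    obtain T where T: "mcs L T"
      using mcs_complete[OF L] \<phi>_notin by blast
    have "subst \<sigma> \<psi> \<in> L"
      using L \<psi> unfolding normal_modal_logic_def closed_subst_def by simp
    then have "subst \<sigma> \<psi> \<in> T"
      using mcs_D(1)[OF T] by auto
    then show ?thesis
      using subst[OF T] by simp
  qed
  then show ?thesis
    unfolding Fin_def validates_def valid_on_def kripke_frame_def by simp
qed

text \<open>Here the marker comes from a fresh variable \<open>p\<close>: if \<open>p\<close>
  differs between a point and a successor, some term in \<open>hub_terms\<close> marks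
  \<open>U\<close>. This leaves the worlds of \<open>G\<close> whose sole successor is themselves,
  and these behave like \<open>refl\<close>.\<close>

lemma Fin_span_no_irr: "Fin (span_logic I) \<subseteq> Fin (fin_logic L)"
proof
  fix G assume "G \<in> Fin (span_logic I)"
  then have G: "kripke_frame G" "finite (fst G)" "validates G (span_logic I)"
    unfolding Fin_def by simp_all
  have valid: "sat G V w \<psi>" if "\<psi> \<in> span_logic I" "w \<in> fst G" for V w \<psi>
    using valid_onD[OF G(1) _ that(2)] G(3) that(1) unfolding validates_def by blast
  have "valid_on G \<mu>" if \<mu>: "\<mu> \<in> fin_logic L" for \<mu>
    unfolding valid_on_def
  proof (intro allI impI ballI)
    fix V w assume w: "w \<in> fst G"
    obtain p where p: "p \<notin> vars \<mu>"
      using ex_fresh by blast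
    \<comment> \<open>With \<open>p\<close> true at \<open>w\<close> alone, failure of
      \<open>?split\<close> means that \<open>w\<close> has no successor but itself.\<close>
    let ?V = "V(p := {w})"
    let ?split = "con (Var p) (dia (neg (Var p)))"
    let ?links = "\<lambda>n. disl (map (\<lambda>q. dle (d + 3) (link q n)) (hub_terms (Var p)))"
    have links: "sat H V' u (?links n) \<longleftrightarrow> (\<exists>q\<in>set (hub_terms (Var p)). sat H V' u (dle (d + 3) (link q n)))"
      for H :: "'w frame" and V' u n
      unfolding sat_disl by (simp only: set_map bex_simps)
    have "sat (frame I) V' u (dis (neg ?split) (?links n))" if u: "u \<in> alive" for V' u n
    proof -
      have "sat (frame I) V' u (?links n)" if split: "sat (frame I) V' u ?split"
      proof -
        have "sat (frame I) V' u (Var p)" "\<not> sat (frame I) V' u (\<box>(Var p))"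
          using split by auto
        then obtain x where x: "(u, x) \<in> snd (frame I)" "\<not> sat (frame I) V' x (Var p)"
          by auto
        moreover have "u \<in> fst (frame I)" "x \<in> fst (frame I)"
          using x(1) kripke[of I] unfolding kripke_frame_def by auto
        ultimately obtain q where "q \<in> set (hub_terms (Var p))" "marks_hub I V' q"
          using marks_hub_terms[of u I V' "Var p" x] \<open>sat (frame I) V' u (Var p)\<close> by blast
        then show ?thesis
          unfolding links using marks_hub_reach_link[OF _ u] by blast
      qed
      then show ?thesis
        unfolding sat.simps(2,3) by blast
    qed
    then have dis: "dis \<mu> (dis (neg ?split) (?links n)) \<in> span_logic I" for n
      by (rule dis_span_logic[OF \<mu>])
    obtain n where "\<forall>q\<in>set (hub_terms (Var p)). \<not> sat G ?V w (dle (d + 3) (link q n))"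
      using finite_frame_no_link[OF G(1,2) w] ..
    then have "\<not> sat G ?V w (?links n)"
      unfolding links by blast
    then have dichotomy: "sat G ?V w \<mu> \<or> \<not> sat G ?V w ?split"
      using valid[OF dis w, of ?V n] unfolding sat.simps(2,3) by blast
    have "sat G V w \<mu> \<longleftrightarrow> sat G ?V w \<mu>"
      by (rule sat_cong_vars) (use p in auto)
    moreover have "sat G ?V w \<mu>" if "\<not> sat G ?V w ?split"
    proof -
      have "u = w" if "(w, u) \<in> snd G" for u
        using \<open>\<not> sat G ?V w ?split\<close> that by auto
      moreover have "\<exists>u. (w, u) \<in> snd G"
        using valid[OF dia_top w, of V] by simp
      ultimately have succ: "(w, u) \<in> snd G \<longleftrightarrow> u = w" for u
        by blast
      have "sat G ?V w \<mu> \<longleftrightarrow> sat refl (\<lambda>q. if w \<in> ?V q then {0} else {}) 0 \<mu>"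
        by (rule sat_morphism[where f = "\<lambda>_. w" and A = "{0}"]) (simp_all add: succ)
      moreover have "sat refl (\<lambda>q. if w \<in> ?V q then {0} else {}) 0 \<mu>"
        using fin_logic_valid[of refl L \<mu>] refl_Fin \<mu> by (intro valid_onD) (auto simp: Fin_def)
      ultimately show ?thesis by simp
    qed
    ultimately show "sat G V w \<mu>"
      using dichotomy by blast
  qed
  then show "G \<in> Fin (fin_logic L)"
    using G unfolding Fin_def validates_def by simp
qed

end

lemma Fin_span_logic: "Fin (span_logic I) = Fin L"
proof
  show "Fin (span_logic I) \<subseteq> Fin L"
    using Fin_span_irr Fin_span_no_irr unfolding Fin_fin_logic by blast
  show "Fin L \<subseteq> Fin (span_logic I)"
    using Fin_antimono[of "span_logic I" "fin_logic L"] unfolding Fin_fin_logic span_logic_def by blast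
qed

subsection \<open>Distinguishing the logics in the span\<close>

text \<open>Truth lemma for the unravelling: the bound on \<open>md \<psi> + i\<close> stops the
  evaluation before a leaf looks into the gadget.\<close>

lemma sat_root:
  assumes root: "Deep i T \<in> deep" "md \<psi> + i \<le> d" "vars \<psi> \<subseteq> vars \<phi>"
    and V: "\<And>p i T. p \<in> vars \<phi> \<Longrightarrow> Base (Deep i T) \<in> V p \<longleftrightarrow> Var p \<in> T"
      "\<And>p c. Base (Shal c) \<in> V p \<longleftrightarrow> p \<in> vars \<phi> \<and> Var p \<in> c"
  shows "sat (frame I) V (Base (Deep i T)) \<psi> \<longleftrightarrow> \<psi> \<in> T"
  using root
proof (induction \<psi> arbitrary: i T)
  case (Var p)
  then show ?case
    using V(1) by simp
next
  case Bot
  then show ?case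
    using mcs_D(3) unfolding Deep_deep by auto
next
  case (Imp \<psi> \<chi>)
  then have "mcs L T"
    unfolding Deep_deep by simp
  with Imp show ?case
    by (simp add: mcs_imp[OF L])
next
  case (Box \<psi>)
  have T: "mcs L T" and i: "i < d" and vars: "vars \<psi> \<subseteq> vars \<phi>"
    using Box.prems unfolding Deep_deep by simp_all
  have deep: "sat (frame I) V (Base (Deep (Suc i) T')) \<psi> \<longleftrightarrow> \<psi> \<in> T'" if "Deep (Suc i) T' \<in> deep" for T'
    using Box.IH[OF that] Box.prems by simp
  have shal: "sat (frame I) V (Base (Shal (restr (vars \<phi>) T'))) \<psi> \<longleftrightarrow> \<psi> \<in> T'" if "T' \<in> fin_depth L d" for T'
  proof -
    have "restr (vars \<phi>) T' \<in> fst (Q d)"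
      using that unfolding depth_frame_def by simp
    then show ?thesis
      using sat_Shal[of _ V "\<lambda>p. {c. p \<in> vars \<phi> \<and> Var p \<in> c}"] V(2)
        sat_depth_frame_self[OF L vars that] by simp
  qed
  show ?case
  proof
    assume box: "sat (frame I) V (Base (Deep i T)) (\<box>\<psi>)"
    have "\<psi> \<in> T'" if T': "mcs L T'" "canon T T'" for T'
    proof (cases "T' \<in> fin_depth L d")
      case True
      then have "(Deep i T, Shal (restr (vars \<phi>) T')) \<in> edges"
        using Box.prems(1) i that(2) unfolding edges_def by blast
      then show ?thesis
        using box shal[OF True] unfolding sat_Base by blast
    next
      case False
      \<comment> \<open>Levels increase, so a point outside level \<open>d\<close> qualifies for a
        \<open>Deep\<close> copy at every distance.\<close>
      then have "T' \<notin> fin_depth L (d - Suc i)"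
        using fin_depth_mono[OF L, of "d - Suc i" d] by auto
      then have "Deep (Suc i) T' \<in> deep"
        using T' i unfolding Deep_deep by simp
      moreover from this have "(Deep i T, Deep (Suc i) T') \<in> edges"
        using Box.prems(1) that(2) unfolding edges_def by blast
      ultimately show ?thesis
        using box deep unfolding sat_Base by blast
    qed
    then show "\<box>\<psi> \<in> T"
      using mcs_box[OF L T] by blast
  next
    assume box: "\<box>\<psi> \<in> T"
    have "sat (frame I) V (Base y) \<psi>" if y: "(Deep i T, y) \<in> edges" for y
    proof -
      consider T' where "y = Deep (Suc i) T'" "Deep (Suc i) T' \<in> deep" "canon T T'"
        | T' where "y = Shal (restr (vars \<phi>) T')" "T' \<in> fin_depth L d" "canon T T'"
        using y unfolding edges_def by auto
      then show ?thesis
        using deep shal box unfolding canon_def by cases auto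
    qed
    moreover have "Deep i T \<notin> leaves"
      using not_leaf(3) i by blast
    ultimately show "sat (frame I) V (Base (Deep i T)) (\<box>\<psi>)"
      unfolding sat_Base by blast
  qed
qed

text \<open>The formula says that \<open>\<phi>\<close> holds or, if \<open>v\<close> marks
  \<open>W\<close> alone, the loop coding \<open>i\<close> is within reach. When \<open>i\<close> is
  not coded, it fails at a root refuting \<open>\<phi>\<close>; as \<open>v\<close> is fresh,
  marking \<open>W\<close> does not disturb that refutation.\<close>

lemma span_logic_mem: "\<exists>\<psi>. \<forall>I. \<psi> \<in> span_logic I \<longleftrightarrow> i \<in> I"
proof -
  obtain v where v: "v \<notin> vars \<phi>"
    using ex_fresh by blast
  let ?\<chi> = "dis (neg (only_W (d + 3) (Var v))) (dle (d + 3) (loop (Var v) i))"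
  have "dis \<phi> ?\<chi> \<in> span_logic I" if "i \<in> I" for I
  proof (rule dis_span_logic[OF \<phi>_fin])
    show "sat (frame I) V w ?\<chi>" if "w \<in> alive" for V w
      unfolding sat.simps(2,3) using only_W_loop[OF that _ \<open>i \<in> I\<close>] by blast
  qed
  moreover have "dis \<phi> ?\<chi> \<notin> span_logic I" if "i \<notin> I" for I
  proof
    assume "dis \<phi> ?\<chi> \<in> span_logic I"
    then have valid: "valid_on (frame I) (dis \<phi> ?\<chi>)"
      unfolding span_logic_def log_def by blast
    obtain T where T: "mcs L T" "\<phi> \<notin> T"
      using mcs_complete[OF L] \<phi>_notin by blast
    \<comment> \<open>A point of finite depth would contain \<open>\<phi>\<close>, since its class
      lies in \<open>Q d\<close>, a finite frame for \<open>L\<close>.\<close>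
    have "T \<notin> fin_depth L d"
    proof
      assume *: "T \<in> fin_depth L d"
      then have "restr (vars \<phi>) T \<in> fst (Q d)"
        unfolding depth_frame_def by simp
      then show False
        using Q_valid[OF _ \<phi>_fin] sat_depth_frame_self[OF L order_refl *] T(2) by blast
    qed
    then have root: "Deep 0 T \<in> deep"
      using T(1) unfolding Deep_deep by simp
    \<comment> \<open>The fresh \<open>v\<close> marks \<open>W\<close>; the other variables are
      read off the canonical points and their classes, as \<open>sat_root\<close> demands.\<close>
    define V where "V p = (if p = v then {W} else
      {Base (Deep j S) | j S. Var p \<in> S} \<union> {Base (Shal c) | c. p \<in> vars \<phi> \<and> Var p \<in> c})" for p
    have "\<not> sat (frame I) V (Base (Deep 0 T)) \<phi>"
      using T(2) v by (subst sat_root[OF root]) (auto simp: V_def)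
    moreover have "V v = {W}"
      unfolding V_def by simp
    then have "sat (frame I) V (Base (Deep 0 T)) (only_W (d + 3) (Var v))"
      "\<not> sat (frame I) V (Base (Deep 0 T)) (dle (d + 3) (loop (Var v) i))"
      using only_W_no_loop[of "Base (Deep 0 T)" V v i I] root \<open>i \<notin> I\<close> by blast+
    moreover have "Base (Deep 0 T) \<in> fst (frame I)"
      using alive_worlds root by blast
    then have "sat (frame I) V (Base (Deep 0 T)) (dis \<phi> ?\<chi>)"
      by (rule valid_onD[OF kripke valid])
    ultimately show False
      unfolding sat.simps(2,3) by blast
  qed
  ultimately show ?thesis by blast
qed

lemma inj_span_logic: "inj span_logic"
proof (rule injI)
  fix I J assume eq: "span_logic I = span_logic J"
  have "i \<in> I \<longleftrightarrow> i \<in> J" for i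
  proof -
    obtain \<psi> where "\<forall>I. \<psi> \<in> span_logic I \<longleftrightarrow> i \<in> I"
      using span_logic_mem by blast
    then show ?thesis
      using eq by metis
  qed
  then show "I = J" by blast
qed

end

section \<open>Cardinality of the set of logics with the same finite frames\<close>

theorem theorem7p1:
  fixes L :: "fm set"
  assumes "normal_modal_logic L"
  shows "degree_of_fmp L =o cone \<or> degree_of_fmp L =o ctwo ^c natLeq"
proof -
  let ?S = "{L'. normal_modal_logic L' \<and> Fin L' = Fin L}"
  have L: "L \<in> ?S" "fin_logic L \<in> ?S"
    using assms normal_fin_logic Fin_fin_logic by simp_all
  show ?thesis
  proof (cases "?S = {fin_logic L}")
    case True
    have "|{fin_logic L}| =o cone"
      unfolding cone_def by (rule card_of_ordIsoI[of "\<lambda>_. ()"]) (simp add: bij_betw_def)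
    then show ?thesis
      unfolding degree_of_fmp_def True by blast
  next
    case False
    then obtain L' where L': "normal_modal_logic L'" "Fin L' = Fin L" "L' \<noteq> fin_logic L"
      using L(2) by blast
    \<comment> \<open>\<open>fin_logic\<close> depends only on the finite frames, so
      \<open>L'\<close> is properly below it and can carry the construction, even if
      \<open>L\<close> itself is the largest logic.\<close>
    have fin: "fin_logic L' = fin_logic L"
      unfolding fin_logic_def L'(2) ..
    then obtain \<phi> where "\<phi> \<in> fin_logic L'" "\<phi> \<notin> L'"
      using L'(3) fin_logic_superset[of L'] by auto
    then interpret incomplete L' \<phi>
      using L'(1) by unfold_locales
    have "range span_logic \<subseteq> ?S"
      using normal_span_logic Fin_span_logic L'(2) by auto
    then have "|UNIV :: nat set set| \<le>o |?S|"
      using inj_span_logic card_of_ordLeq by blast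
    \<comment> \<open>There are countably many formulas, hence at most continuum many
      logics.\<close>
    moreover have "inj (\<lambda>A :: fm set. to_nat ` A)"
      by (simp add: inj_image_eq_iff inj_on_def)
    then have "|?S| \<le>o |UNIV :: nat set set|"
      using card_of_ordLeqI[of "\<lambda>A :: fm set. to_nat ` A" ?S "UNIV :: nat set set"]
      by (simp add: inj_on_def)
    ultimately have "|?S| =o |UNIV :: nat set set|"
      using ordIso_iff_ordLeq by blast
    moreover have "|UNIV :: nat set set| =o ctwo ^c natLeq"
      using card_of_Pow_Func[of "UNIV :: nat set"] unfolding cexp_def ctwo_def Field_natLeq Field_card_of by simp
    ultimately show ?thesis
      unfolding degree_of_fmp_def using ordIso_transitive by blast
  qed
qed

end
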